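(* Let $n\ge 2$, $k\in\mathbb Z_+$ and $B\ge 0$. Let $f$ be a smooth function on $\mathbb R^n$ such that $|x|^m f(x)$ is bounded on $\mathbb R^n$ for each $m\in\mathbb Z_+$. Suppose $f\ast\mu_{r,j}^k(x)=0$ for all $x\in\mathbb R^n$, all $r>|x|+B$ and all $j$ with $1\le j\le d_k$. Then $f(x)=0$ whenever $|x|>B$.
   Context: $\mathbb Z_+$ is the set of non-negative integers. $P_k$ is the space of all homogeneous polynomials of degree $k$ on $\mathbb R^n$ (complex coefficients), $H_k=\{P\in P_k:\Delta P=0\}$ is the space of solid spherical harmonics of degree $k$, and $d_k=\dim H_k$. Fix an orthonormal basis $\{P_{kj}:1\le j\le d_k\}$ of $H_k$ (orthonormal for restrictions to $S^{n-1}$ in $L^2(S^{n-1})$). For $r>0$, $\mu_r$ is the normalized surface measure on $S_r(o)=\{y\in\mathbb R^n:|y|=r\}$. The weighted spherical mean of $f\in L^1_{\mathrm{loc}}(\mathbb R^n)$ is $$f\ast\mu_{r,j}^k(x)=\int_{S_r(o)}f(x+y)P_{kj}(y)\,d\mu_r(y).$$ *)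

theory Defs
  imports "HOL-Analysis.Analysis" "HOL-Probability.Probability" "HOL-Library.Function_Algebras"
begin

definition partial_derivative :: "'n \<Rightarrow> (real ^ 'n \<Rightarrow> complex) \<Rightarrow> real ^ 'n::finite \<Rightarrow> complex" where
  "partial_derivative i f x = vector_derivative (\<lambda>t. f (x + t *\<^sub>R axis i 1)) (at 0)"

text \<open>Differentiability is required at each stage because \<^const>\<open>vector_derivative\<close> is total.\<close>

primrec C_class :: "nat \<Rightarrow> (real ^ 'n::finite \<Rightarrow> complex) \<Rightarrow> bool" where
  "C_class 0 f \<longleftrightarrow> continuous_on UNIV f"
| "C_class (Suc m) f \<longleftrightarrow> (\<forall>x. f differentiable (at x)) \<and> (\<forall>i. C_class m (partial_derivative i f))"

definition smooth :: "(real ^ 'n::finite \<Rightarrow> complex) \<Rightarrow> bool" where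
  "smooth f \<longleftrightarrow> (\<forall>m. C_class m f)"

definition laplacian :: "(real ^ 'n::finite \<Rightarrow> complex) \<Rightarrow> real ^ 'n \<Rightarrow> complex" where
  "laplacian f x = (\<Sum>i\<in>UNIV. partial_derivative i (partial_derivative i f) x)"

definition multi_indices :: "nat \<Rightarrow> ('n::finite \<Rightarrow> nat) set" where
  "multi_indices k = {\<alpha>. (\<Sum>i\<in>UNIV. \<alpha> i) = k}"

lemma finite_multi_indices: "finite (multi_indices k :: ('n::finite \<Rightarrow> nat) set)"
proof (rule finite_subset)
  show "multi_indices k \<subseteq> (\<Pi>\<^sub>E i\<in>UNIV. {..k})"
    unfolding multi_indices_def by (auto simp: PiE_def intro: member_le_sum)
  show "finite (\<Pi>\<^sub>E i\<in>(UNIV :: 'n set). {..k})"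
    by (intro finite_PiE) auto
qed

definition homogeneous_polynomials :: "nat \<Rightarrow> (real ^ 'n::finite \<Rightarrow> complex) set" where
  "homogeneous_polynomials k =
     {P. \<exists>c. \<forall>x. P x = (\<Sum>\<alpha>\<in>multi_indices k. c \<alpha> * of_real (\<Prod>i\<in>UNIV. (x $ i) ^ \<alpha> i))}"

definition solid_harmonics :: "nat \<Rightarrow> (real ^ 'n::finite \<Rightarrow> complex) set" where
  "solid_harmonics k = {P \<in> homogeneous_polynomials k. \<forall>x. laplacian P x = 0}"

text \<open>The complex vector space of all complex-valued functions on a type;
  \<open>cfun.span\<close> and \<open>cfun.dim\<close> are the complex span and dimension.\<close>

definition cfun_scale :: "complex \<Rightarrow> ('a \<Rightarrow> complex) \<Rightarrow> 'a \<Rightarrow> complex" where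
  "cfun_scale c P = (\<lambda>x. c * P x)"

global_interpretation cfun: vector_space "cfun_scale :: complex \<Rightarrow> ('a \<Rightarrow> complex) \<Rightarrow> 'a \<Rightarrow> complex"
  by unfold_locales (auto simp: cfun_scale_def fun_eq_iff algebra_simps)

definition harmonic_dim :: "'n::finite itself \<Rightarrow> nat \<Rightarrow> nat" where
  "harmonic_dim _ k = cfun.dim (solid_harmonics k :: (real ^ 'n \<Rightarrow> complex) set)"

text \<open>The normalized surface measure on the sphere of radius \<open>r > 0\<close> about the origin,
  as a Borel measure on the whole space concentrated on that sphere. As usual for polar
  coordinates, a subset \<open>E\<close> of the sphere is given the normalized volume of the cone of all
  \<open>y\<close> in the unit ball with \<open>r y / |y|\<close> in \<open>E\<close>; that \<open>sgn 0 = 0\<close> does not matter, since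
  \<open>{0}\<close> is a null set.\<close>

definition sphere_measure :: "real \<Rightarrow> (real ^ 'n::finite) measure" where
  "sphere_measure r = distr (uniform_measure lborel (ball 0 1)) borel (\<lambda>y. r *\<^sub>R sgn y)"

lemma measurable_sgn_scale [measurable]:
  "(\<lambda>y::real ^ 'n::finite. r *\<^sub>R sgn y) \<in> borel_measurable borel"
  unfolding sgn_div_norm by measurable

lemma emeasure_ball_01: "emeasure lborel (ball (0::real ^ 'n::finite) 1) \<noteq> 0"
    "emeasure lborel (ball (0::real ^ 'n::finite) 1) \<noteq> \<infinity>"
  using content_ball_pos[of 1 "0::real ^ 'n"] emeasure_lborel_ball_finite[of "0::real ^ 'n" 1]
  by (auto simp: measure_def)

lemma prob_space_sphere_measure: "prob_space (sphere_measure r :: (real ^ 'n::finite) measure)"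
  unfolding sphere_measure_def
  by (intro prob_space.prob_space_distr prob_space_uniform_measure) (use emeasure_ball_01 in auto)

lemma AE_sphere_measure:
  assumes "r > 0"
  shows "AE y in (sphere_measure r :: (real ^ 'n::finite) measure). y \<in> sphere 0 r"
proof -
  have "AE y in lborel. (y::real ^ 'n) \<noteq> 0"
    by (rule AE_lborel_singleton)
  then have "AE y in lborel. (y::real ^ 'n) \<in> ball 0 1 \<longrightarrow> r *\<^sub>R sgn y \<in> sphere 0 r"
    by eventually_elim (use assms in \<open>auto simp: norm_sgn\<close>)
  then show ?thesis
    unfolding sphere_measure_def
    by (subst AE_distr_iff) (auto intro!: AE_uniform_measureI)
qed

definition sphere_inner :: "(real ^ 'n::finite \<Rightarrow> complex) \<Rightarrow> (real ^ 'n \<Rightarrow> complex) \<Rightarrow> complex" where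
  "sphere_inner P Q = (LINT y|sphere_measure 1. P y * cnj (Q y))"

definition orthonormal_harmonic_basis :: "nat \<Rightarrow> (nat \<Rightarrow> real ^ 'n::finite \<Rightarrow> complex) \<Rightarrow> bool" where
  "orthonormal_harmonic_basis k P \<longleftrightarrow>
     (\<forall>j\<in>{1..harmonic_dim TYPE('n) k}. P j \<in> solid_harmonics k) \<and>
     (\<forall>i\<in>{1..harmonic_dim TYPE('n) k}. \<forall>j\<in>{1..harmonic_dim TYPE('n) k}.
        sphere_inner (P i) (P j) = (if i = j then 1 else 0)) \<and>
     cfun.span (P ` {1..harmonic_dim TYPE('n) k}) = solid_harmonics k"

definition weighted_spherical_mean ::
    "(real ^ 'n::finite \<Rightarrow> complex) \<Rightarrow> (real ^ 'n \<Rightarrow> complex) \<Rightarrow> real \<Rightarrow> real ^ 'n \<Rightarrow> complex" where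
  "weighted_spherical_mean f P r x = (LINT y|sphere_measure r. f (x + y) * P y)"

end

theory Submission
  imports Defs
begin

text \<open>
Everything is expressed through integrals over the outside of balls. Fix a polynomial \<open>S\<close> and
consider the property that
\<open>\<integral> f (x + y) S(y) u(|y|\<^sup>2) dy = 0\<close>
for every \<open>x\<close> and every continuous weight \<open>u\<close> of polynomial growth whose support lies in some
\<open>[\<rho>, \<infinity>)\<close> with \<open>\<rho> > (|x| + B)\<^sup>2\<close> (\<open>exterior_null B f S\<close>). Integration in polar coordinates
turns the hypothesis into this property for \<open>S\<close> in the given basis, hence for every \<open>S\<close> in \<open>H\<^sub>k\<close>.

The point \<open>x\<close> may be moved a little without leaving the range of the property, so it may be
differentiated in \<open>x\<close>, and the derivative falls on the kernel (\<open>exterior_null_partial\<close>): if the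
property holds for \<open>Q\<close> and \<open>K(y) = Q(y) h(|y|\<^sup>2)\<close>, then \<open>\<integral> f (x + y) \<partial>\<^sub>i K(y) dy = 0\<close>. It is used
in two ways.

Lowering the degree. For \<open>S\<close> in \<open>H\<^sub>l\<close> put \<open>Q\<^sub>i = y\<^sub>i S - |y|\<^sup>2 \<partial>\<^sub>i S / (n + 2l - 2)\<close>, where the second term
is absent for \<open>l = 0\<close> because \<open>S\<close> is then constant. These polynomials lie
in \<open>H\<^sub>l\<^sub>+\<^sub>1\<close>, and with a constant \<open>c \<noteq> 0\<close> they satisfy \<open>\<Sum> y\<^sub>i Q\<^sub>i = c |y|\<^sup>2 S\<close> and
\<open>\<Sum> \<partial>\<^sub>i Q\<^sub>i = (n + 2l) c S\<close>. So the sum over \<open>i\<close> of the differentiated kernels is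
\<open>2 c S(y) (a h(q) + q h'(q))\<close> with \<open>q = |y|\<^sup>2\<close> and \<open>a = (n + 2l) / 2\<close>. Every weight \<open>u\<close> has the form
\<open>a h + q h'\<close> with weights \<open>h\<close> and \<open>h'\<close> supported in the same half-line (\<open>admissible_euler_ode\<close>), so the
property descends from degree \<open>l + 1\<close> to degree \<open>l\<close> (\<open>exterior_null_lower_degree\<close>), and in the end
to \<open>S = 1\<close>. The solution \<open>h\<close> need not have bounded support even if \<open>u\<close> has; therefore weights of
polynomial growth are admitted, and the rapid decrease of \<open>f\<close> makes the integrals converge.

Multiplying by polynomials. For \<open>S = 1\<close> one argues as in Helgason's proof of the support theorem:
\<open>\<partial>\<^sub>i (h(|y|\<^sup>2)) = 2 y\<^sub>i h'(|y|\<^sup>2)\<close>, so \<open>\<integral> f (x + y) y\<^sub>i u(|y|\<^sup>2) dy = 0\<close> for every \<open>u\<close>, and adding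
\<open>x\<^sub>i\<close> times the property itself shows that \<open>z \<mapsto> z\<^sub>i f(z)\<close> has it as well
(\<open>exterior_null_coord_mult\<close>). By induction \<open>p f\<close> has it for every polynomial \<open>p\<close>. At \<open>x = 0\<close> this
says that \<open>f\<close> times a radial bump outside the ball of radius \<open>B\<close> is orthogonal to all polynomials,
and by the Weierstrass approximation theorem it vanishes.
\<close>

section \<open>Polar coordinates\<close>

lemma nn_integral_lborel_scale:
  fixes g :: "'a::euclidean_space \<Rightarrow> ennreal"
  assumes [measurable]: "g \<in> borel_measurable borel" and "t > 0"
  shows "(\<integral>\<^sup>+y. g y \<partial>lborel) = ennreal (t ^ DIM('a)) * (\<integral>\<^sup>+y. g (t *\<^sub>R y) \<partial>lborel)"
proof -
  let ?w = "\<lambda>x::'a. ennreal (\<bar>t\<bar> ^ DIM('a))"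
  have [measurable]: "(\<lambda>x::'a. 0 + t *\<^sub>R x) \<in> lborel \<rightarrow>\<^sub>M borel" by simp
  have "(\<integral>\<^sup>+y. g y \<partial>lborel) = (\<integral>\<^sup>+y. g y \<partial>density (distr lborel borel (\<lambda>x. 0 + t *\<^sub>R x)) ?w)"
    by (subst lborel_affine[of t 0]) (use assms(2) in simp_all)
  also have "\<dots> = (\<integral>\<^sup>+y. ?w y * g y \<partial>distr lborel borel (\<lambda>x. 0 + t *\<^sub>R x))"
    by (rule nn_integral_density) simp_all
  also have "\<dots> = (\<integral>\<^sup>+y. ?w (0 + t *\<^sub>R y) * g (0 + t *\<^sub>R y) \<partial>lborel)"
    by (rule nn_integral_distr) simp_all
  also have "\<dots> = (\<integral>\<^sup>+y. ennreal (t ^ DIM('a)) * g (t *\<^sub>R y) \<partial>lborel)"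
    using assms(2) by simp
  also have "\<dots> = ennreal (t ^ DIM('a)) * (\<integral>\<^sup>+y. g (t *\<^sub>R y) \<partial>lborel)"
    by (rule nn_integral_cmult) measurable
  finally show ?thesis .
qed

lemma nn_integral_inverse_power_tail:
  fixes a :: real
  assumes "a > 0" "n > 0"
  shows "(\<integral>\<^sup>+t. ennreal (1 / t ^ Suc n) * indicator {a<..} t \<partial>lborel) = ennreal (1 / (real n * a ^ n))"
proof -
  have "(\<integral>\<^sup>+t. ennreal (1 / t ^ Suc n) * indicator {a<..} t \<partial>lborel)
     = (\<integral>\<^sup>+t. ennreal (1 / t ^ Suc n) * indicator {a..} t \<partial>lborel)"
    by (rule nn_integral_cong_AE, rule eventually_mono[OF AE_lborel_singleton[of a]]) (simp add: indicator_def)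
  also have "\<dots> = ennreal (0 - (- (inverse a ^ n) / real n))"
  proof (rule nn_integral_FTC_atLeast)
    fix t :: real assume "a \<le> t"
    then have t: "t > 0" using assms by simp
    obtain m where m: "n = Suc m" using assms by (cases n) auto
    show "((\<lambda>t. - (inverse t ^ n) / real n) has_real_derivative 1 / t ^ Suc n) (at t)"
    proof -
      have "((\<lambda>t. - (inverse t ^ n) / real n) has_real_derivative
          - (real n * (- (inverse t ^ Suc (Suc 0)) * inverse t ^ (n - Suc 0))) / real n) (at t)"
        by (intro DERIV_cdivide DERIV_minus DERIV_power DERIV_inverse) (use t in simp)
      also have "- (real n * (- (inverse t ^ Suc (Suc 0)) * inverse t ^ (n - Suc 0))) / real n = 1 / t ^ Suc n"
      proof -
        have "- (N * (- (v ^ Suc (Suc 0)) * v ^ m)) / N = v ^ Suc (Suc m)" if "N \<noteq> 0" for N v :: real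
          using that by simp
        from this[of "real n" "inverse t"] show ?thesis
          using assms by (simp only: m diff_Suc_1 diff_Suc_Suc diff_zero of_nat_eq_0_iff)
             (simp only: inverse_eq_divide power_one_over nat.distinct not_False_eq_True simp_thms)
      qed
      finally show ?thesis .
    qed
    show "0 \<le> 1 / t ^ Suc n" using t by simp
  next
    have "((\<lambda>t. - (inverse t ^ n) / real n) \<longlongrightarrow> - (0 ^ n) / real n) at_top"
      by (intro tendsto_intros tendsto_inverse_0_at_top filterlim_ident) (use assms in auto)
    moreover have "- (0 ^ n) / real n = (0::real)"
      using assms by simp
    ultimately show "((\<lambda>t. - (inverse t ^ n) / real n) \<longlongrightarrow> 0) at_top"
      by metis
  qed simp
  finally show ?thesis
    by (simp only: inverse_eq_divide power_one_over diff_0 minus_divide_left[symmetric] minus_minus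
        divide_divide_eq_left mult.commute[of "a ^ n"])
qed

lemma borel_measurable_sgn [measurable]: "sgn \<in> borel_measurable (borel :: 'a::euclidean_space measure)"
proof -
  have "(\<lambda>y::'a. sgn y) \<in> borel_measurable borel"
    unfolding sgn_div_norm by measurable
  then show ?thesis by simp
qed

text \<open>Polar coordinates from scaling and Tonelli's theorem alone. For fixed \<open>y \<noteq> 0\<close> the substitution
\<open>r = t |y|\<close> turns \<open>r sgn y\<close> into \<open>t y\<close>. After an exchange of the integrals, \<open>z = t y\<close> runs through
the ball of radius \<open>t\<close>, and the integral of \<open>t\<^sup>-\<^sup>n\<^sup>-\<^sup>1\<close> over \<open>t > |z|\<close> cancels the factor \<open>|z|\<^sup>n\<close>
that the substitutions have produced.\<close>

lemma nn_integral_polar: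
  fixes G :: "'a::euclidean_space \<Rightarrow> ennreal"
  assumes G [measurable]: "G \<in> borel_measurable borel"
  shows "(\<integral>\<^sup>+z. G z \<partial>lborel) = of_nat DIM('a) *
    (\<integral>\<^sup>+r. ennreal (r ^ (DIM('a) - 1)) * indicator {0<..} r *
       (\<integral>\<^sup>+y. G (r *\<^sub>R sgn y) * indicator (ball 0 1) y \<partial>lborel) \<partial>lborel)"
proof -
  let ?n = "DIM('a)"
  obtain m where m: "?n = Suc m" using DIM_positive[where 'a='a] by (cases ?n) auto
  define C :: "'a \<Rightarrow> ennreal" where "C = indicator (ball 0 1)"
  have [measurable]: "C \<in> borel_measurable borel"
    unfolding C_def by (intro borel_measurable_indicator borel_open open_ball)
  \<comment> \<open>the substitution \<open>r = t |y|\<close>\<close>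
  have radial: "(\<integral>\<^sup>+r. ennreal (r ^ m) * indicator {0<..} r * (G (r *\<^sub>R sgn y) * C y) \<partial>lborel)
      = (\<integral>\<^sup>+t. ennreal (t ^ m * norm y ^ ?n) * indicator {0<..} t * (G (t *\<^sub>R y) * C y) \<partial>lborel)"
    if "y \<noteq> 0" for y
  proof -
    have "(\<integral>\<^sup>+r. ennreal (r ^ m) * indicator {0<..} r * (G (r *\<^sub>R sgn y) * C y) \<partial>lborel)
       = ennreal \<bar>norm y\<bar> * (\<integral>\<^sup>+t. ennreal ((0 + norm y * t) ^ m) * indicator {0<..} (0 + norm y * t) *
           (G ((0 + norm y * t) *\<^sub>R sgn y) * C y) \<partial>lborel)"
      using that by (intro nn_integral_real_affine) auto
    also have "\<dots> = (\<integral>\<^sup>+t. ennreal (norm y) * (ennreal ((norm y * t) ^ m) * indicator {0<..} (norm y * t) *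
           (G ((norm y * t) *\<^sub>R sgn y) * C y)) \<partial>lborel)"
      by (simp add: nn_integral_cmult)
    also have "\<dots> = (\<integral>\<^sup>+t. ennreal (t ^ m * norm y ^ ?n) * indicator {0<..} t * (G (t *\<^sub>R y) * C y) \<partial>lborel)"
    proof (intro nn_integral_cong)
      fix t :: real
      have eq: "(norm y * t) *\<^sub>R sgn y = t *\<^sub>R y"
        using that by (simp add: sgn_div_norm)
      show "ennreal (norm y) * (ennreal ((norm y * t) ^ m) * indicator {0<..} (norm y * t) *
           (G ((norm y * t) *\<^sub>R sgn y) * C y)) =
           ennreal (t ^ m * norm y ^ ?n) * indicator {0<..} t * (G (t *\<^sub>R y) * C y)"
      proof (cases "t > 0")
        case True
        have "ennreal (norm y) * ennreal ((norm y * t) ^ m) = ennreal (t ^ m * norm y ^ ?n)"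
          using True by (subst ennreal_mult[symmetric]) (auto simp: m power_mult_distrib)
        then show ?thesis using True that eq by (simp add: mult.assoc[symmetric])
      next
        case False
        then show ?thesis using that by (simp add: zero_less_mult_iff indicator_def)
      qed
    qed
    finally show ?thesis .
  qed
  \<comment> \<open>the substitution \<open>z = t y\<close>, which maps the unit ball to the ball of radius \<open>t\<close>\<close>
  have cone: "(\<integral>\<^sup>+y. ennreal (t ^ m * norm y ^ ?n) * indicator {0<..} t * (G (t *\<^sub>R y) * C y) \<partial>lborel)
      = (\<integral>\<^sup>+z. G z * (ennreal (norm z ^ ?n) * (ennreal (1 / t ^ Suc ?n) * (if norm z < t then 1 else 0))) \<partial>lborel)" for t
  proof (cases "t > 0")
    case True
    have "(\<integral>\<^sup>+z. G z * (ennreal (norm z ^ ?n) * (ennreal (1 / t ^ Suc ?n) * (if norm z < t then 1 else 0))) \<partial>lborel)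
      = ennreal (t ^ ?n) * (\<integral>\<^sup>+y. G (t *\<^sub>R y) * (ennreal (norm (t *\<^sub>R y) ^ ?n) *
          (ennreal (1 / t ^ Suc ?n) * (if norm (t *\<^sub>R y) < t then 1 else 0))) \<partial>lborel)"
      by (rule nn_integral_lborel_scale[OF _ True]) measurable
    also have "\<dots> = (\<integral>\<^sup>+y. ennreal (t ^ ?n) * (G (t *\<^sub>R y) * (ennreal (norm (t *\<^sub>R y) ^ ?n) *
          (ennreal (1 / t ^ Suc ?n) * (if norm (t *\<^sub>R y) < t then 1 else 0)))) \<partial>lborel)"
      by (intro nn_integral_cmult[symmetric]) measurable
    also have "\<dots> = (\<integral>\<^sup>+y. ennreal (t ^ m * norm y ^ ?n) * indicator {0<..} t * (G (t *\<^sub>R y) * C y) \<partial>lborel)"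
    proof (intro nn_integral_cong)
      fix y :: 'a
      have e: "ennreal (t ^ ?n) * (ennreal (norm (t *\<^sub>R y) ^ ?n) * ennreal (1 / t ^ Suc ?n)) = ennreal (t ^ m * norm y ^ ?n)"
      proof -
        have "t ^ ?n * (norm (t *\<^sub>R y) ^ ?n * (1 / t ^ Suc ?n)) = t ^ m * norm y ^ ?n"
          using True by (simp add: m power_mult_distrib)
        then show ?thesis
          using True by (simp only: ennreal_mult[symmetric] zero_le_power norm_ge_zero less_imp_le
              divide_nonneg_nonneg zero_le_one mult_nonneg_nonneg)
      qed
      have i: "(if norm (t *\<^sub>R y) < t then 1 else 0) = C y"
        using True by (auto simp: C_def indicator_def)
      have "ennreal (t ^ ?n) * (G (t *\<^sub>R y) * (ennreal (norm (t *\<^sub>R y) ^ ?n) *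
          (ennreal (1 / t ^ Suc ?n) * (if norm (t *\<^sub>R y) < t then 1 else 0)))) =
        (ennreal (t ^ ?n) * (ennreal (norm (t *\<^sub>R y) ^ ?n) * ennreal (1 / t ^ Suc ?n))) * (G (t *\<^sub>R y) * C y)"
        unfolding i by (simp only: ac_simps)
      then show "ennreal (t ^ ?n) * (G (t *\<^sub>R y) * (ennreal (norm (t *\<^sub>R y) ^ ?n) *
          (ennreal (1 / t ^ Suc ?n) * (if norm (t *\<^sub>R y) < t then 1 else 0)))) =
        ennreal (t ^ m * norm y ^ ?n) * indicator {0<..} t * (G (t *\<^sub>R y) * C y)"
        unfolding e using True by simp
    qed
    finally show ?thesis by simp
  next
    case False
    have "(if norm z < t then 1 else 0) = (0::ennreal)" for z :: 'a
      using False norm_ge_zero[of z] by (auto simp del: norm_ge_zero)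
    then show ?thesis using False by simp
  qed
  have "(\<integral>\<^sup>+r. ennreal (r ^ (?n - 1)) * indicator {0<..} r *
       (\<integral>\<^sup>+y. G (r *\<^sub>R sgn y) * C y \<partial>lborel) \<partial>lborel)
     = (\<integral>\<^sup>+r. (\<integral>\<^sup>+y. ennreal (r ^ m) * indicator {0<..} r *
         (G (r *\<^sub>R sgn y) * C y) \<partial>lborel) \<partial>lborel)"
    unfolding m diff_Suc_1 by (intro nn_integral_cong nn_integral_cmult[symmetric]) measurable
  also have "\<dots> = (\<integral>\<^sup>+y. (\<integral>\<^sup>+r. ennreal (r ^ m) * indicator {0<..} r *
         (G (r *\<^sub>R sgn y) * C y) \<partial>lborel) \<partial>lborel)"
    by (rule lborel_pair.Fubini') (unfold split_beta, measurable)
  also have "\<dots> = (\<integral>\<^sup>+y. (\<integral>\<^sup>+t. ennreal (t ^ m * norm y ^ ?n) * indicator {0<..} t *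
         (G (t *\<^sub>R y) * C y) \<partial>lborel) \<partial>lborel)"
    by (rule nn_integral_cong_AE, rule eventually_mono[OF AE_lborel_singleton[of "0::'a"]], rule radial)
  also have "\<dots> = (\<integral>\<^sup>+t. (\<integral>\<^sup>+y. ennreal (t ^ m * norm y ^ ?n) * indicator {0<..} t *
         (G (t *\<^sub>R y) * C y) \<partial>lborel) \<partial>lborel)"
    by (rule lborel_pair.Fubini') (unfold split_beta, measurable)
  also have "\<dots> = (\<integral>\<^sup>+z. (\<integral>\<^sup>+t. G z * (ennreal (norm z ^ ?n) *
         (ennreal (1 / t ^ Suc ?n) * (if norm z < t then 1 else 0))) \<partial>lborel) \<partial>lborel)"
    unfolding cone by (rule lborel_pair.Fubini') (unfold split_beta, measurable)
  also have "\<dots> = (\<integral>\<^sup>+z. G z * (ennreal (norm z ^ ?n) *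
         (\<integral>\<^sup>+t. ennreal (1 / t ^ Suc ?n) * (if norm z < t then 1 else 0) \<partial>lborel)) \<partial>lborel)"
    by (intro nn_integral_cong, subst nn_integral_cmult, measurable, subst nn_integral_cmult, measurable)
  also have "\<dots> = (\<integral>\<^sup>+z. G z * ennreal (1 / ?n) \<partial>lborel)"
  proof (intro nn_integral_cong_AE)
    have "G z * (ennreal (norm z ^ ?n) *
         (\<integral>\<^sup>+t. ennreal (1 / t ^ Suc ?n) * (if norm z < t then 1 else 0) \<partial>lborel)) = G z * ennreal (1 / ?n)"
      if "z \<noteq> 0" for z
    proof -
      have i: "(if norm z < t then 1 else 0) = (indicator {norm z<..} t :: ennreal)" for t
        by (simp add: indicator_def)
      have p: "norm z ^ ?n > 0" and d: "real ?n > 0"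
        using that by (auto simp: DIM_positive)
      have cancel: "ennreal p * ennreal (1 / (q * p)) = ennreal (1 / q)" if "p > 0" "q > 0" for p q :: real
        using that by (simp add: ennreal_mult[symmetric])
      show ?thesis
        unfolding i using that by (subst nn_integral_inverse_power_tail) (auto simp only: cancel p d zero_less_norm_iff DIM_positive)
    qed
    then show "AE z in lborel. G z * (ennreal (norm z ^ ?n) *
         (\<integral>\<^sup>+t. ennreal (1 / t ^ Suc ?n) * (if norm z < t then 1 else 0) \<partial>lborel)) = G z * ennreal (1 / ?n)"
      by (rule eventually_mono[OF AE_lborel_singleton[of "0::'a"]])
  qed
  also have "\<dots> = (\<integral>\<^sup>+z. G z \<partial>lborel) * ennreal (1 / ?n)"
    by (rule nn_integral_multc) simp
  finally have *: "(\<integral>\<^sup>+r. ennreal (r ^ (?n - 1)) * indicator {0<..} r *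
       (\<integral>\<^sup>+y. G (r *\<^sub>R sgn y) * C y \<partial>lborel) \<partial>lborel)
     = (\<integral>\<^sup>+z. G z \<partial>lborel) * ennreal (1 / ?n)" .
  have "of_nat ?n * ((\<integral>\<^sup>+z. G z \<partial>lborel) * ennreal (1 / ?n))
      = (of_nat ?n * ennreal (1 / ?n)) * (\<integral>\<^sup>+z. G z \<partial>lborel)"
    by (simp only: ac_simps)
  also have "of_nat ?n * ennreal (1 / ?n) = 1"
    by (simp add: ennreal_of_nat_eq_real_of_nat ennreal_mult[symmetric])
  finally show ?thesis
    unfolding *[unfolded C_def] by simp
qed

abbreviation uniform_ball :: "'a::euclidean_space measure" where
  "uniform_ball \<equiv> uniform_measure lborel (ball 0 1)"

text \<open>The surface area of the sphere of radius \<open>r\<close>, so that the integral over a sphere is taken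
against a probability measure.\<close>

definition polar_weight :: "'a::euclidean_space itself \<Rightarrow> real \<Rightarrow> real" where
  "polar_weight _ r = (if r > 0 then DIM('a) * measure lborel (ball (0::'a) 1) * r ^ (DIM('a) - 1) else 0)"

lemma polar_weight_nonneg: "polar_weight TYPE('a::euclidean_space) r \<ge> 0"
  by (simp add: polar_weight_def)

lemma borel_measurable_polar_weight [measurable]:
  "polar_weight TYPE('a::euclidean_space) \<in> borel_measurable borel"
  unfolding polar_weight_def[abs_def] by measurable

lemma emeasure_unit_ball:
  "emeasure lborel (ball (0::'a::euclidean_space) 1) = ennreal (measure lborel (ball (0::'a) 1))"
  using emeasure_lborel_ball_finite[of "0::'a" 1] by (intro emeasure_eq_ennreal_measure) auto

lemma measure_unit_ball_pos: "measure lborel (ball (0::'a::euclidean_space) 1) > 0"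
  using content_ball_pos[of 1 "0::'a"] by simp

lemma prob_space_uniform_ball: "prob_space (uniform_ball :: 'a::euclidean_space measure)"
  using measure_unit_ball_pos[where 'a='a]
  by (intro prob_space_uniform_measure) (auto simp: emeasure_unit_ball)

lemma pair_sigma_finite_polar: "pair_sigma_finite lborel (uniform_ball :: 'a::euclidean_space measure)"
proof -
  interpret U: prob_space "uniform_ball :: 'a measure" by (rule prob_space_uniform_ball)
  show ?thesis ..
qed

lemma nn_integral_polar_uniform:
  fixes G :: "'a::euclidean_space \<Rightarrow> ennreal"
  assumes G [measurable]: "G \<in> borel_measurable borel"
  shows "(\<integral>\<^sup>+z. G z \<partial>lborel) =
    (\<integral>\<^sup>+r. ennreal (polar_weight TYPE('a) r) * (\<integral>\<^sup>+y. G (r *\<^sub>R sgn y) \<partial>uniform_ball) \<partial>lborel)"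
proof -
  let ?V = "measure lborel (ball (0::'a) 1)"
  have V: "?V > 0" by (rule measure_unit_ball_pos)
  have "ennreal (polar_weight TYPE('a) r) * (\<integral>\<^sup>+y. G (r *\<^sub>R sgn y) \<partial>uniform_ball) =
     of_nat DIM('a) * (ennreal (r ^ (DIM('a) - 1)) * indicator {0<..} r *
       (\<integral>\<^sup>+y. G (r *\<^sub>R sgn y) * indicator (ball 0 1) y \<partial>lborel))" for r
  proof (cases "r > 0")
    case True
    define I where "I = (\<integral>\<^sup>+y. G (r *\<^sub>R sgn y) * indicator (ball 0 1) y \<partial>lborel)"
    have I: "(\<integral>\<^sup>+y. G (r *\<^sub>R sgn y) \<partial>uniform_ball) = I / ennreal ?V"
      unfolding I_def emeasure_unit_ball[symmetric]
      by (rule nn_integral_uniform_measure) simp_all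
    have w: "ennreal (polar_weight TYPE('a) r) = of_nat DIM('a) * ennreal (r ^ (DIM('a) - 1)) * ennreal ?V"
      using True V by (simp add: polar_weight_def ennreal_mult[symmetric] ennreal_of_nat_eq_real_of_nat ac_simps)
    have "ennreal ?V * (I / ennreal ?V) = I"
      using V by (simp add: ennreal_times_divide mult.commute ennreal_mult_divide_eq)
    then show ?thesis
      unfolding I w I_def[symmetric] using True by (simp add: mult.assoc)
  next
    case False
    then show ?thesis by (simp add: polar_weight_def)
  qed
  moreover have "(\<lambda>r. ennreal (r ^ (DIM('a) - 1)) * indicator {0<..} r *
       (\<integral>\<^sup>+y. G (r *\<^sub>R sgn y) * indicator (ball 0 1) y \<partial>lborel)) \<in> borel_measurable lborel"
  proof -
    have [measurable]: "(indicator (ball (0::'a) 1) :: 'a \<Rightarrow> ennreal) \<in> borel_measurable borel"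
      by (intro borel_measurable_indicator borel_open open_ball)
    show ?thesis by measurable
  qed
  ultimately show ?thesis
    unfolding nn_integral_polar[OF G] by (subst nn_integral_cmult[symmetric]) simp_all
qed

text \<open>The formula as an identity of measures, which also gives it for integrals of complex functions.\<close>

lemma lborel_eq_polar:
  "(lborel :: 'a::euclidean_space measure) =
     distr (density (lborel \<Otimes>\<^sub>M uniform_ball) (\<lambda>p. ennreal (polar_weight TYPE('a) (fst p))))
       borel (\<lambda>p. fst p *\<^sub>R sgn (snd p))"
proof (rule measure_eqI)
  interpret pair_sigma_finite lborel "uniform_ball :: 'a measure" by (rule pair_sigma_finite_polar)
  fix A :: "'a set" assume "A \<in> sets lborel"
  then have [measurable]: "A \<in> sets borel" by simp
  have s [measurable]: "(\<lambda>p. fst p *\<^sub>R sgn (snd p)) \<in> borel_measurable (lborel \<Otimes>\<^sub>M (uniform_ball :: 'a measure))"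
    by measurable
  have "emeasure lborel A = (\<integral>\<^sup>+z. indicator A z \<partial>lborel)" by simp
  also have "\<dots> = (\<integral>\<^sup>+r. ennreal (polar_weight TYPE('a) r) * (\<integral>\<^sup>+y. indicator A (r *\<^sub>R sgn y) \<partial>uniform_ball) \<partial>lborel)"
    by (rule nn_integral_polar_uniform) simp
  also have "\<dots> = (\<integral>\<^sup>+r. (\<integral>\<^sup>+y. ennreal (polar_weight TYPE('a) r) * indicator A (r *\<^sub>R sgn y) \<partial>uniform_ball) \<partial>lborel)"
    by (intro nn_integral_cong nn_integral_cmult[symmetric]) measurable
  also have "\<dots> = (\<integral>\<^sup>+p. ennreal (polar_weight TYPE('a) (fst p)) * indicator A (fst p *\<^sub>R sgn (snd p)) \<partial>(lborel \<Otimes>\<^sub>M uniform_ball))"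
    using M2.nn_integral_fst[of "\<lambda>p. ennreal (polar_weight TYPE('a) (fst p)) * indicator A (fst p *\<^sub>R sgn (snd p))" lborel]
    by simp
  also have "\<dots> = (\<integral>\<^sup>+p. indicator A (fst p *\<^sub>R sgn (snd p)) \<partial>density (lborel \<Otimes>\<^sub>M uniform_ball) (\<lambda>p. ennreal (polar_weight TYPE('a) (fst p))))"
    by (rule nn_integral_density[symmetric]) measurable
  also have "\<dots> = (\<integral>\<^sup>+z. indicator A z \<partial>distr (density (lborel \<Otimes>\<^sub>M uniform_ball) (\<lambda>p. ennreal (polar_weight TYPE('a) (fst p))))
       borel (\<lambda>p. fst p *\<^sub>R sgn (snd p)))"
    by (rule nn_integral_distr[symmetric]) (use s in simp_all)
  also have "\<dots> = emeasure (distr (density (lborel \<Otimes>\<^sub>M uniform_ball) (\<lambda>p. ennreal (polar_weight TYPE('a) (fst p))))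
       borel (\<lambda>p. fst p *\<^sub>R sgn (snd p))) A"
    by (rule nn_integral_indicator) simp
  finally show "emeasure lborel A = \<dots>" .
qed simp

text \<open>Fubini's theorem: the integral over the space is an integral of the means over spheres.\<close>

lemma lborel_integral_eq_0_of_sphere_means:
  fixes g :: "real ^ 'n::finite \<Rightarrow> complex"
  assumes g: "integrable lborel g"
    and zero: "\<And>r. r > 0 \<Longrightarrow> (LINT y|sphere_measure r. g y) = 0"
  shows "(LINT y|lborel. g y) = 0"
proof -
  let ?U = "uniform_ball :: (real ^ 'n) measure" and ?w = "polar_weight TYPE(real ^ 'n)"
  interpret pair_sigma_finite lborel ?U by (rule pair_sigma_finite_polar)
  have [measurable]: "g \<in> borel_measurable borel"
    using borel_measurable_integrable[OF g] by simp
  have [measurable]: "(\<lambda>p. fst p *\<^sub>R sgn (snd p)) \<in> borel_measurable (lborel \<Otimes>\<^sub>M ?U)"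
    by measurable
  let ?D = "density (lborel \<Otimes>\<^sub>M ?U) (\<lambda>p. ennreal (?w (fst p)))"
  let ?F = "\<lambda>p. ?w (fst p) *\<^sub>R g (fst p *\<^sub>R sgn (snd p))"
  have "integrable ?D (\<lambda>p. g (fst p *\<^sub>R sgn (snd p)))"
    using g by (subst (asm) lborel_eq_polar, subst (asm) integrable_distr_eq) simp_all
  then have int: "integrable (lborel \<Otimes>\<^sub>M ?U) ?F"
    by (subst (asm) integrable_density) (auto simp: polar_weight_nonneg)
  have inner: "(LINT y|?U. ?w r *\<^sub>R g (r *\<^sub>R sgn y)) = 0" for r
  proof (cases "r > 0")
    case True
    have "(LINT y|sphere_measure r. g y) = (LINT y|?U. g (r *\<^sub>R sgn y))"
      unfolding sphere_measure_def by (rule integral_distr) simp_all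
    then show ?thesis using zero[OF True] by simp
  qed (simp add: polar_weight_def)
  have "(LINT y|lborel. g y) = (LINT p|?D. g (fst p *\<^sub>R sgn (snd p)))"
    by (subst lborel_eq_polar, subst integral_distr) simp_all
  also have "\<dots> = (LINT p|(lborel \<Otimes>\<^sub>M ?U). ?F p)"
    by (rule integral_density) (auto simp: polar_weight_nonneg)
  also have "\<dots> = (LINT r|lborel. LINT y|?U. ?w r *\<^sub>R g (r *\<^sub>R sgn y))"
    using integral_fst'[OF int] by simp
  finally show ?thesis
    unfolding inner by simp
qed

section \<open>Polynomial growth and rapid decrease\<close>

definition poly_growth :: "('a::real_normed_vector \<Rightarrow> 'b::real_normed_vector) \<Rightarrow> bool" where
  "poly_growth G \<longleftrightarrow> (\<exists>C N. \<forall>x. norm (G x) \<le> C * (1 + norm x) ^ N)"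

definition rapidly_decreasing :: "('a::real_normed_vector \<Rightarrow> 'b::real_normed_vector) \<Rightarrow> bool" where
  "rapidly_decreasing f \<longleftrightarrow> (\<forall>N. \<exists>C. \<forall>x. norm (f x) * (1 + norm x) ^ N \<le> C)"

lemma poly_growthE:
  assumes "poly_growth G"
  obtains C N where "C \<ge> 0" "\<And>x. norm (G x) \<le> C * (1 + norm x) ^ N"
proof -
  obtain C N where CN: "\<And>x. norm (G x) \<le> C * (1 + norm x) ^ N"
    using assms unfolding poly_growth_def by auto
  have "C \<ge> 0" using order_trans[OF norm_ge_zero CN[of 0]] by simp
  with CN that show thesis by blast
qed

lemma poly_growthI:
  assumes "\<And>x. norm (G x) \<le> C * (1 + norm x) ^ N"
  shows "poly_growth G"
  using assms unfolding poly_growth_def by blast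

lemma poly_growth_const: "poly_growth (\<lambda>x. c)"
  by (rule poly_growthI[where C="norm c" and N=0]) simp

lemma poly_growth_add:
  assumes "poly_growth F" "poly_growth G"
  shows "poly_growth (\<lambda>x. F x + G x)"
proof -
  obtain C M where F: "C \<ge> 0" "\<And>x. norm (F x) \<le> C * (1 + norm x) ^ M" using assms(1) by (rule poly_growthE) blast
  obtain D N where G: "D \<ge> 0" "\<And>x. norm (G x) \<le> D * (1 + norm x) ^ N" using assms(2) by (rule poly_growthE) blast
  show ?thesis
  proof (rule poly_growthI)
    fix x
    have "norm (F x + G x) \<le> C * (1 + norm x) ^ M + D * (1 + norm x) ^ N"
      by (rule norm_triangle_le) (intro add_mono F G)
    also have "\<dots> \<le> C * (1 + norm x) ^ (M + N) + D * (1 + norm x) ^ (M + N)"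
      by (intro add_mono mult_left_mono power_increasing F G) auto
    finally show "norm (F x + G x) \<le> (C + D) * (1 + norm x) ^ (M + N)"
      by (simp add: distrib_right)
  qed
qed

lemma poly_growth_mult:
  fixes F G :: "'a::real_normed_vector \<Rightarrow> 'b::real_normed_algebra"
  assumes "poly_growth F" "poly_growth G"
  shows "poly_growth (\<lambda>x. F x * G x)"
proof -
  obtain C M where F: "C \<ge> 0" "\<And>x. norm (F x) \<le> C * (1 + norm x) ^ M" using assms(1) by (rule poly_growthE) blast
  obtain D N where G: "D \<ge> 0" "\<And>x. norm (G x) \<le> D * (1 + norm x) ^ N" using assms(2) by (rule poly_growthE) blast
  show ?thesis
  proof (rule poly_growthI)
    fix x
    have "norm (F x * G x) \<le> norm (F x) * norm (G x)" by (rule norm_mult_ineq)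
    also have "\<dots> \<le> (C * (1 + norm x) ^ M) * (D * (1 + norm x) ^ N)"
      by (intro mult_mono F G mult_nonneg_nonneg) auto
    finally show "norm (F x * G x) \<le> (C * D) * (1 + norm x) ^ (M + N)"
      by (simp add: power_add ac_simps)
  qed
qed

lemma poly_growth_bounded:
  assumes "\<And>x. norm (G x) \<le> C"
  shows "poly_growth G"
  using assms by (intro poly_growthI[where C=C and N=0]) simp

lemma poly_growth_minus: "poly_growth F \<Longrightarrow> poly_growth (\<lambda>x. - F x)"
  unfolding poly_growth_def by simp

lemma poly_growth_diff: "poly_growth F \<Longrightarrow> poly_growth G \<Longrightarrow> poly_growth (\<lambda>x. F x - G x)"
  using poly_growth_add[of F "\<lambda>x. - G x"] poly_growth_minus[of G] by simp

lemma poly_growth_sum: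
  "(\<And>i. i \<in> I \<Longrightarrow> poly_growth (F i)) \<Longrightarrow> poly_growth (\<lambda>x. \<Sum>i\<in>I. F i x)"
  by (induction I rule: infinite_finite_induct) (auto intro: poly_growth_add poly_growth_const)

lemma poly_growth_nth: "poly_growth (\<lambda>x. complex_of_real (x $ (i::'n::finite)))"
proof (rule poly_growthI[where C=1 and N=1])
  fix x :: "real ^ 'n"
  have "\<bar>x $ i\<bar> \<le> norm x" by (rule component_le_norm_cart)
  then show "norm (complex_of_real (x $ i)) \<le> 1 * (1 + norm x) ^ 1" by simp
qed

text \<open>The bound follows from \<open>1 + |y|\<^sup>2 \<le> (1 + |y|)\<^sup>2\<close>.\<close>

lemma poly_growth_of_radial:
  fixes u :: "real \<Rightarrow> real"
  assumes "poly_growth u"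
  shows "poly_growth (\<lambda>y::real ^ 'n::finite. complex_of_real (u (y \<bullet> y)))"
proof -
  obtain C N where u: "C \<ge> 0" "\<And>q. norm (u q) \<le> C * (1 + norm q) ^ N" using assms by (rule poly_growthE) blast
  show ?thesis
  proof (rule poly_growthI)
    fix y :: "real ^ 'n"
    have "norm (complex_of_real (u (y \<bullet> y))) \<le> C * (1 + norm (y \<bullet> y)) ^ N"
      using u(2)[of "y \<bullet> y"] by simp
    also have "\<dots> \<le> C * ((1 + norm y) ^ 2) ^ N"
      by (intro mult_left_mono power_mono u)
         (auto simp: power2_norm_eq_inner[symmetric] power2_sum)
    finally show "norm (complex_of_real (u (y \<bullet> y))) \<le> C * (1 + norm y) ^ (2 * N)"
      by (simp add: power_mult)
  qed
qed

text \<open>The bound follows from \<open>1 + |y + a| \<le> (1 + |a|) (1 + |y|)\<close>.\<close>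

lemma poly_growth_translate:
  fixes G :: "'a::real_normed_vector \<Rightarrow> 'b::real_normed_vector"
  assumes "poly_growth G"
  shows "poly_growth (\<lambda>y. G (y + a))"
proof -
  obtain C N where G: "C \<ge> 0" "\<And>x. norm (G x) \<le> C * (1 + norm x) ^ N" using assms by (rule poly_growthE) blast
  show ?thesis
  proof (rule poly_growthI)
    fix y :: 'a
    have "(1 + norm a) * (1 + norm y) = 1 + norm a + norm y + norm a * norm y"
      by (simp add: algebra_simps)
    then have "1 + norm (y + a) \<le> (1 + norm a) * (1 + norm y)"
      using norm_triangle_ineq[of y a] mult_nonneg_nonneg[OF norm_ge_zero[of a] norm_ge_zero[of y]]
      by linarith
    then have "C * (1 + norm (y + a)) ^ N \<le> C * ((1 + norm a) * (1 + norm y)) ^ N"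
      by (intro mult_left_mono power_mono G) auto
    then show "norm (G (y + a)) \<le> (C * (1 + norm a) ^ N) * (1 + norm y) ^ N"
      using G(2)[of "y + a"] by (simp add: power_mult_distrib mult.assoc)
  qed
qed

lemma rapidly_decreasing_mult:
  fixes f G :: "'a::real_normed_vector \<Rightarrow> 'b::real_normed_algebra"
  assumes "rapidly_decreasing f" "poly_growth G"
  shows "rapidly_decreasing (\<lambda>x. f x * G x)"
  unfolding rapidly_decreasing_def
proof
  fix M
  obtain D N where G: "D \<ge> 0" "\<And>x. norm (G x) \<le> D * (1 + norm x) ^ N" using assms(2) by (rule poly_growthE) blast
  obtain C where C: "\<And>x. norm (f x) * (1 + norm x) ^ (N + M) \<le> C"
    using assms(1) unfolding rapidly_decreasing_def by meson
  show "\<exists>C. \<forall>x. norm (f x * G x) * (1 + norm x) ^ M \<le> C"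
  proof (intro exI allI)
    fix x
    have "norm (f x * G x) * (1 + norm x) ^ M \<le> norm (f x) * norm (G x) * (1 + norm x) ^ M"
      by (intro mult_right_mono norm_mult_ineq) simp
    also have "\<dots> \<le> norm (f x) * (D * (1 + norm x) ^ N) * (1 + norm x) ^ M"
      by (intro mult_right_mono mult_left_mono G) auto
    also have "\<dots> = D * (norm (f x) * (1 + norm x) ^ (N + M))"
      by (simp add: power_add ac_simps)
    also have "\<dots> \<le> D * C"
      by (intro mult_left_mono C G)
    finally show "norm (f x * G x) * (1 + norm x) ^ M \<le> D * C" .
  qed
qed

text \<open>Powers of \<open>|x|\<close> control powers of \<open>1 + |x|\<close> because \<open>(1 + |x|)\<^sup>N \<le> 2\<^sup>N (1 + |x|\<^sup>N)\<close>.\<close>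

lemma rapidly_decreasing_of_moments:
  fixes f :: "'a::real_normed_vector \<Rightarrow> 'b::real_normed_vector"
  assumes "\<And>m::nat. bounded (range (\<lambda>x. norm x ^ m *\<^sub>R f x))"
  shows "rapidly_decreasing f"
  unfolding rapidly_decreasing_def
proof
  fix N
  have "\<exists>C. \<forall>x. norm x ^ m * norm (f x) \<le> C" for m
    using assms[of m] by (simp add: bounded_iff)
  then have "\<forall>m. \<exists>C. \<forall>x. norm x ^ m * norm (f x) \<le> C" by blast
  from choice[OF this] obtain C where C: "\<And>m x. norm x ^ m * norm (f x) \<le> C m" by blast
  show "\<exists>C. \<forall>x. norm (f x) * (1 + norm x) ^ N \<le> C"
  proof (intro exI allI)
    fix x :: 'a
    have "(1 + norm x) ^ N \<le> 2 ^ N * (1 + norm x ^ N)"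
    proof (cases "norm x \<le> 1")
      case True
      then have "(1 + norm x) ^ N \<le> 2 ^ N" by (intro power_mono) auto
      also have "\<dots> \<le> 2 ^ N * (1 + norm x ^ N)" by simp
      finally show ?thesis .
    next
      case False
      then have "(1 + norm x) ^ N \<le> (2 * norm x) ^ N" by (intro power_mono) auto
      also have "\<dots> = 2 ^ N * norm x ^ N" by (rule power_mult_distrib)
      also have "\<dots> \<le> 2 ^ N * (1 + norm x ^ N)" by simp
      finally show ?thesis .
    qed
    then have "norm (f x) * (1 + norm x) ^ N \<le> norm (f x) * (2 ^ N * (1 + norm x ^ N))"
      by (intro mult_left_mono) auto
    also have "\<dots> = 2 ^ N * (norm x ^ 0 * norm (f x) + norm x ^ N * norm (f x))"
      by (simp add: algebra_simps)
    also have "\<dots> \<le> 2 ^ N * (C 0 + C N)"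
      by (intro mult_left_mono add_mono C) auto
    finally show "norm (f x) * (1 + norm x) ^ N \<le> 2 ^ N * (C 0 + C N)" .
  qed
qed

lemma rapidly_decreasing_add:
  assumes "rapidly_decreasing f" "rapidly_decreasing g"
  shows "rapidly_decreasing (\<lambda>x. f x + g x)"
  unfolding rapidly_decreasing_def
proof
  fix N
  obtain C where C: "\<And>x. norm (f x) * (1 + norm x) ^ N \<le> C"
    using assms(1) unfolding rapidly_decreasing_def by meson
  obtain D where D: "\<And>x. norm (g x) * (1 + norm x) ^ N \<le> D"
    using assms(2) unfolding rapidly_decreasing_def by meson
  show "\<exists>C. \<forall>x. norm (f x + g x) * (1 + norm x) ^ N \<le> C"
  proof (intro exI allI)
    fix x
    have "norm (f x + g x) * (1 + norm x) ^ N \<le> (norm (f x) + norm (g x)) * (1 + norm x) ^ N"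
      by (intro mult_right_mono norm_triangle_ineq) simp
    then show "norm (f x + g x) * (1 + norm x) ^ N \<le> C + D"
      using C[of x] D[of x] by (simp add: distrib_right)
  qed
qed

lemma rapidly_decreasing_translate:
  fixes f :: "'a::real_normed_vector \<Rightarrow> 'b::real_normed_vector"
  assumes "rapidly_decreasing f"
  shows "rapidly_decreasing (\<lambda>y. f (a + y))"
  unfolding rapidly_decreasing_def
proof
  fix N
  obtain C where C: "\<And>x. norm (f x) * (1 + norm x) ^ N \<le> C"
    using assms unfolding rapidly_decreasing_def by meson
  show "\<exists>C. \<forall>y. norm (f (a + y)) * (1 + norm y) ^ N \<le> C"
  proof (intro exI allI)
    fix y :: 'a
    have "(1 + norm a) * (1 + norm (a + y)) = 1 + norm a + norm (a + y) + norm a * norm (a + y)"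
      by (simp add: algebra_simps)
    moreover have "norm y \<le> norm (a + y) + norm a"
      using norm_triangle_ineq4[of "a + y" a] by simp
    ultimately have "1 + norm y \<le> (1 + norm a) * (1 + norm (a + y))"
      using mult_nonneg_nonneg[OF norm_ge_zero[of a] norm_ge_zero[of "a + y"]] by linarith
    then have "norm (f (a + y)) * (1 + norm y) ^ N \<le> norm (f (a + y)) * ((1 + norm a) * (1 + norm (a + y))) ^ N"
      by (intro mult_left_mono power_mono) auto
    also have "\<dots> = (1 + norm a) ^ N * (norm (f (a + y)) * (1 + norm (a + y)) ^ N)"
      by (simp add: power_mult_distrib ac_simps)
    also have "\<dots> \<le> (1 + norm a) ^ N * C"
      by (intro mult_left_mono C) simp
    finally show "norm (f (a + y)) * (1 + norm y) ^ N \<le> (1 + norm a) ^ N * C" .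
  qed
qed

lemma nn_integral_inverse_square: "(\<integral>\<^sup>+r. ennreal (1 / (1 + r) ^ 2) * indicator {0..} r \<partial>lborel) = ennreal 1"
proof -
  have "(\<integral>\<^sup>+r. ennreal (1 / (1 + r) ^ 2) * indicator {0..} r \<partial>lborel) = ennreal (0 - (- inverse (1 + 0)))"
  proof (rule nn_integral_FTC_atLeast)
    fix r :: real assume "0 \<le> r"
    then show "((\<lambda>r. - inverse (1 + r)) has_real_derivative 1 / (1 + r) ^ 2) (at r)"
      by (auto intro!: derivative_eq_intros simp: power2_eq_square divide_inverse)
  next
    have "filterlim (\<lambda>r::real. 1 + r) at_top at_top"
      by (rule filterlim_tendsto_add_at_top[OF tendsto_const filterlim_ident])
    then have "((\<lambda>r::real. - inverse (1 + r)) \<longlongrightarrow> - 0) at_top"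
      by (intro tendsto_minus tendsto_inverse_0_at_top)
    then show "((\<lambda>r::real. - inverse (1 + r)) \<longlongrightarrow> 0) at_top" by simp
  qed auto
  then show ?thesis by simp
qed

text \<open>In polar coordinates the integrand is at most \<open>r\<^sup>n\<^sup>-\<^sup>1 / (1 + r)\<^sup>n\<^sup>+\<^sup>1 \<le> (1 + r)\<^sup>-\<^sup>2\<close> times a constant.\<close>

lemma integrable_inverse_power_norm:
  "integrable lborel (\<lambda>y::'a::euclidean_space. 1 / (1 + norm y) ^ Suc DIM('a))"
proof -
  let ?n = "DIM('a)" and ?g = "\<lambda>y::'a. 1 / (1 + norm y) ^ Suc DIM('a)"
  let ?U = "uniform_ball :: 'a measure"
  let ?c = "?n * measure lborel (ball (0::'a) 1)"
  interpret U: prob_space ?U by (rule prob_space_uniform_ball)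
  have ne: "AE y in ?U. y \<noteq> 0"
    using AE_lborel_singleton[of "0::'a"] by (intro AE_uniform_measureI) (auto elim: eventually_mono)
  have "(\<integral>\<^sup>+y. ennreal (?g y) \<partial>lborel) =
     (\<integral>\<^sup>+r. ennreal (polar_weight TYPE('a) r) * (\<integral>\<^sup>+y. ennreal (?g (r *\<^sub>R sgn y)) \<partial>?U) \<partial>lborel)"
    by (rule nn_integral_polar_uniform) measurable
  also have "\<dots> \<le> (\<integral>\<^sup>+r. ennreal ?c * (ennreal (1 / (1 + r) ^ 2) * indicator {0..} r) \<partial>lborel)"
  proof (intro nn_integral_mono)
    fix r :: real
    show "ennreal (polar_weight TYPE('a) r) * (\<integral>\<^sup>+y. ennreal (?g (r *\<^sub>R sgn y)) \<partial>?U)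
        \<le> ennreal ?c * (ennreal (1 / (1 + r) ^ 2) * indicator {0..} r)"
    proof (cases "r > 0")
      case True
      obtain m where m: "?n = Suc m" using DIM_positive[where 'a='a] by (cases ?n) auto
      have "(\<integral>\<^sup>+y. ennreal (?g (r *\<^sub>R sgn y)) \<partial>?U) = (\<integral>\<^sup>+y. ennreal (1 / (1 + r) ^ Suc ?n) \<partial>?U)"
        by (rule nn_integral_cong_AE, rule eventually_mono[OF ne]) (use True in \<open>simp add: norm_sgn\<close>)
      also have "\<dots> = ennreal (1 / (1 + r) ^ Suc ?n)"
        using U.emeasure_space_1 by simp
      finally have "ennreal (polar_weight TYPE('a) r) * (\<integral>\<^sup>+y. ennreal (?g (r *\<^sub>R sgn y)) \<partial>?U)
          = ennreal (polar_weight TYPE('a) r * (1 / (1 + r) ^ Suc ?n))"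
        using True by (simp only: ennreal_mult[OF polar_weight_nonneg]) (simp add: ennreal_mult[symmetric] polar_weight_nonneg)
      also have "\<dots> \<le> ennreal (?c * (1 / (1 + r) ^ 2))"
      proof (rule ennreal_leI)
        have "r ^ m \<le> (1 + r) ^ m" using True by (intro power_mono) auto
        then have "r ^ m * (1 / (1 + r) ^ Suc (Suc m)) \<le> (1 + r) ^ m * (1 / (1 + r) ^ Suc (Suc m))"
          using True by (intro mult_right_mono) auto
        also have "\<dots> = 1 / (1 + r) ^ 2"
          using True by (simp add: power2_eq_square)
        finally have "?c * (r ^ m * (1 / (1 + r) ^ Suc (Suc m))) \<le> ?c * (1 / (1 + r) ^ 2)"
          by (intro mult_left_mono) auto
        then show "polar_weight TYPE('a) r * (1 / (1 + r) ^ Suc ?n) \<le> ?c * (1 / (1 + r) ^ 2)"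
          using True by (simp add: polar_weight_def m mult.assoc del: power_Suc)
      qed
      also have "\<dots> = ennreal ?c * (ennreal (1 / (1 + r) ^ 2) * indicator {0..} r)"
        using True by (subst ennreal_mult) auto
      finally show ?thesis .
    qed (simp add: polar_weight_def)
  qed
  also have "\<dots> = ennreal ?c * (\<integral>\<^sup>+r. ennreal (1 / (1 + r) ^ 2) * indicator {0..} r \<partial>lborel)"
    by (rule nn_integral_cmult) measurable
  also have "\<dots> < \<infinity>"
    unfolding nn_integral_inverse_square by (simp add: ennreal_mult_less_top)
  finally show ?thesis
    by (intro integrableI_nonneg) auto
qed

lemma integrable_rapidly_decreasing:
  fixes f :: "'a::euclidean_space \<Rightarrow> complex"
  assumes "rapidly_decreasing f" and [measurable]: "f \<in> borel_measurable borel"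
  shows "integrable lborel f"
proof -
  obtain C where C: "\<And>x. norm (f x) * (1 + norm x) ^ Suc DIM('a) \<le> C"
    using assms(1) unfolding rapidly_decreasing_def by meson
  show ?thesis
  proof (rule Bochner_Integration.integrable_bound)
    show "integrable lborel (\<lambda>y::'a. C * (1 / (1 + norm y) ^ Suc DIM('a)))"
      by (intro integrable_mult_right integrable_inverse_power_norm)
    have "norm (f x) \<le> norm (C * (1 / (1 + norm x) ^ Suc DIM('a)))" for x
    proof -
      have "(1 + norm x) ^ Suc DIM('a) > 0" by (intro zero_less_power add_pos_nonneg) auto
      then have "norm (f x) \<le> C / (1 + norm x) ^ Suc DIM('a)"
        using C[of x] by (simp only: pos_le_divide_eq)
      then show ?thesis by (simp add: abs_if)
    qed
    then show "AE x in lborel. norm (f x) \<le> norm (C * (1 / (1 + norm x) ^ Suc DIM('a)))" by simp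
  qed simp
qed

section \<open>Partial derivatives of homogeneous polynomials\<close>

text \<open>Partial derivatives as a relation: \<^const>\<open>partial_derivative\<close> is total and does not record that
the derivative exists.\<close>

definition has_partial :: "'n \<Rightarrow> (real ^ 'n::finite \<Rightarrow> complex) \<Rightarrow> (real ^ 'n \<Rightarrow> complex) \<Rightarrow> bool" where
  "has_partial i F F' \<longleftrightarrow> (\<forall>x. ((\<lambda>t. F (x + t *\<^sub>R axis i 1)) has_vector_derivative F' x) (at 0))"

text \<open>The definition asks for the derivative at the base point of each line only; moving the base point
along the line gives it everywhere on the line, as the mean value theorem requires.\<close>

lemma has_partial_shift:
  assumes "has_partial i F F'"
  shows "((\<lambda>t. F (x + t *\<^sub>R axis i 1)) has_vector_derivative F' (x + s *\<^sub>R axis i 1)) (at s)"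
proof -
  have "((\<lambda>t. F (x + s *\<^sub>R axis i 1 + t *\<^sub>R axis i 1)) has_vector_derivative F' (x + s *\<^sub>R axis i 1)) (at (s - s))"
    using assms unfolding has_partial_def by simp
  then have "((\<lambda>t. F (x + s *\<^sub>R axis i 1 + t *\<^sub>R axis i 1)) \<circ> (\<lambda>t. t - s) has_vector_derivative 1 *\<^sub>R F' (x + s *\<^sub>R axis i 1)) (at s)"
    by (intro vector_diff_chain_at) (auto intro!: derivative_eq_intros)
  then show ?thesis
    by (simp add: o_def algebra_simps)
qed

lemma partial_derivative_eq: "has_partial i F F' \<Longrightarrow> partial_derivative i F = F'"
  unfolding has_partial_def partial_derivative_def[abs_def] by (auto intro!: ext vector_derivative_at)

lemma has_partial_const: "has_partial i (\<lambda>x. c) (\<lambda>x. 0)"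
  by (simp add: has_partial_def)

lemma has_partial_coord:
  "has_partial i (\<lambda>x. complex_of_real (x $ j)) (\<lambda>x. if i = j then 1 else 0)"
  unfolding has_partial_def
  by (auto simp: axis_def intro!: derivative_eq_intros)

lemma has_partial_add:
  "has_partial i F F' \<Longrightarrow> has_partial i G G' \<Longrightarrow> has_partial i (\<lambda>x. F x + G x) (\<lambda>x. F' x + G' x)"
  unfolding has_partial_def by (auto intro!: derivative_eq_intros)

lemma has_partial_diff:
  "has_partial i F F' \<Longrightarrow> has_partial i G G' \<Longrightarrow> has_partial i (\<lambda>x. F x - G x) (\<lambda>x. F' x - G' x)"
  unfolding has_partial_def by (auto intro!: derivative_eq_intros)

lemma has_partial_mult:
  assumes "has_partial i F F'" "has_partial i G G'"
  shows "has_partial i (\<lambda>x. F x * G x) (\<lambda>x. F' x * G x + F x * G' x)"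
  unfolding has_partial_def
proof
  fix x
  have "((\<lambda>t. F (x + t *\<^sub>R axis i 1) * G (x + t *\<^sub>R axis i 1)) has_vector_derivative
      F (x + 0 *\<^sub>R axis i 1) * G' x + F' x * G (x + 0 *\<^sub>R axis i 1)) (at 0)"
    using assms unfolding has_partial_def by (intro has_vector_derivative_mult) auto
  then show "((\<lambda>t. F (x + t *\<^sub>R axis i 1) * G (x + t *\<^sub>R axis i 1)) has_vector_derivative F' x * G x + F x * G' x) (at 0)"
    by (simp add: add.commute)
qed

lemma has_partial_cmult:
  "has_partial i F F' \<Longrightarrow> has_partial i (\<lambda>x. c * F x) (\<lambda>x. c * F' x)"
  by (drule has_partial_mult[OF has_partial_const[of i c]]) simp

lemma has_partial_sum:
  "(\<And>j. j \<in> I \<Longrightarrow> has_partial i (F j) (F' j)) \<Longrightarrow> has_partial i (\<lambda>x. \<Sum>j\<in>I. F j x) (\<lambda>x. \<Sum>j\<in>I. F' j x)"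
  by (induction I rule: infinite_finite_induct) (auto intro: has_partial_add has_partial_const)

lemma has_partial_radial:
  assumes "\<And>q. (u has_real_derivative u' q) (at q)"
  shows "has_partial i (\<lambda>y. complex_of_real (u (y \<bullet> y))) (\<lambda>y. complex_of_real (2 * y $ i * u' (y \<bullet> y)))"
  unfolding has_partial_def
proof
  fix y :: "real ^ 'a"
  have q: "((\<lambda>t. (y + t *\<^sub>R axis i 1) \<bullet> (y + t *\<^sub>R axis i 1)) has_real_derivative 2 * y $ i) (at 0)"
  proof -
    have "(y + t *\<^sub>R axis i 1) \<bullet> (y + t *\<^sub>R axis i 1) = y \<bullet> y + 2 * t * y $ i + t * t" for t
      by (simp add: inner_add_left inner_add_right inner_axis inner_axis' inner_commute algebra_simps)
    then show ?thesis by (auto intro!: derivative_eq_intros)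
  qed
  have "((\<lambda>t. u ((y + t *\<^sub>R axis i 1) \<bullet> (y + t *\<^sub>R axis i 1))) has_real_derivative u' ((y + 0 *\<^sub>R axis i 1) \<bullet> (y + 0 *\<^sub>R axis i 1)) * (2 * y $ i)) (at 0)"
    by (rule DERIV_chain2[OF assms q])
  then have "((\<lambda>t. u ((y + t *\<^sub>R axis i 1) \<bullet> (y + t *\<^sub>R axis i 1))) has_real_derivative 2 * y $ i * u' (y \<bullet> y)) (at 0)"
    by (simp add: mult.commute)
  then show "((\<lambda>t. complex_of_real (u ((y + t *\<^sub>R axis i 1) \<bullet> (y + t *\<^sub>R axis i 1)))) has_vector_derivative complex_of_real (2 * y $ i * u' (y \<bullet> y))) (at 0)"
    unfolding has_real_derivative_iff_has_vector_derivative
    by (rule bounded_linear.has_vector_derivative[OF bounded_linear_of_real])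
qed

lemma has_partial_norm_sq:
  "has_partial i (\<lambda>y. complex_of_real (y \<bullet> y)) (\<lambda>y. 2 * complex_of_real (y $ i))"
  using has_partial_radial[of "\<lambda>q. q" "\<lambda>q. 1" i] by simp

definition monomial :: "('n::finite \<Rightarrow> nat) \<Rightarrow> real ^ 'n \<Rightarrow> complex" where
  "monomial \<alpha> x = complex_of_real (\<Prod>i\<in>UNIV. (x $ i) ^ \<alpha> i)"

lemma monomial_split: "monomial \<alpha> x = complex_of_real ((x $ i) ^ \<alpha> i) * complex_of_real (\<Prod>j\<in>UNIV - {i}. (x $ j) ^ \<alpha> j)"
  unfolding monomial_def by (subst prod.remove[of UNIV i]) auto

lemma coord_mult_monomial: "complex_of_real (x $ i) * monomial \<alpha> x = monomial (\<alpha>(i := Suc (\<alpha> i))) x"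
  by (simp add: monomial_split[of _ _ i] mult.assoc)

lemma has_partial_monomial:
  "has_partial i (monomial \<alpha>) (\<lambda>x. of_nat (\<alpha> i) * monomial (\<alpha>(i := \<alpha> i - 1)) x)"
  unfolding has_partial_def
proof
  fix x :: "real ^ 'a"
  let ?c = "\<Prod>j\<in>UNIV - {i}. (x $ j) ^ \<alpha> j"
  have eq: "monomial \<alpha> (x + t *\<^sub>R axis i 1) = complex_of_real ((x $ i + t) ^ \<alpha> i * ?c)" for t
  proof -
    have "(\<Prod>j\<in>UNIV - {i}. ((x + t *\<^sub>R axis i 1) $ j) ^ \<alpha> j) = ?c"
      by (rule prod.cong) (auto simp: axis_def)
    moreover have "(x + t *\<^sub>R axis i 1) $ i = x $ i + t"
      by (simp add: axis_def)
    ultimately show ?thesis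
      unfolding monomial_split[of _ _ i] by (simp only: of_real_mult)
  qed
  have "((\<lambda>t. (x $ i + t) ^ \<alpha> i * ?c) has_real_derivative of_nat (\<alpha> i) * (x $ i) ^ (\<alpha> i - 1) * ?c) (at 0)"
    proof -
    have "((\<lambda>t. (a + t) ^ n * b) has_real_derivative of_nat n * a ^ (n - 1) * b) (at 0)" for a b :: real and n
      by (auto intro!: derivative_eq_intros)
    then show ?thesis .
  qed
  then have "((\<lambda>t. complex_of_real ((x $ i + t) ^ \<alpha> i * ?c)) has_vector_derivative complex_of_real (of_nat (\<alpha> i) * (x $ i) ^ (\<alpha> i - 1) * ?c)) (at 0)"
    unfolding has_real_derivative_iff_has_vector_derivative
    by (rule bounded_linear.has_vector_derivative[OF bounded_linear_of_real])
  then show "((\<lambda>t. monomial \<alpha> (x + t *\<^sub>R axis i 1)) has_vector_derivative of_nat (\<alpha> i) * monomial (\<alpha>(i := \<alpha> i - 1)) x) (at 0)"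
    unfolding eq by (simp add: monomial_split[of _ x i] mult.assoc)
qed

lemma homogeneous_iff:
  "P \<in> homogeneous_polynomials k \<longleftrightarrow> (\<exists>c. P = (\<lambda>x. \<Sum>\<alpha>\<in>multi_indices k. c \<alpha> * monomial \<alpha> x))"
  by (simp only: homogeneous_polynomials_def monomial_def mem_Collect_eq fun_eq_iff)

lemma homogeneous_zero: "(\<lambda>x. 0) \<in> homogeneous_polynomials k"
  unfolding homogeneous_iff by (rule exI[of _ "\<lambda>_. 0"]) simp

lemma homogeneous_monomial:
  assumes "(\<Sum>i\<in>UNIV. \<alpha> i) = k"
  shows "monomial \<alpha> \<in> homogeneous_polynomials k"
proof -
  have \<alpha>: "\<alpha> \<in> multi_indices k" using assms by (simp add: multi_indices_def)
  have "monomial \<alpha> x = (\<Sum>\<beta>\<in>multi_indices k. (if \<beta> = \<alpha> then 1 else 0) * monomial \<beta> x)" for x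
  proof -
    have "(\<Sum>\<beta>\<in>multi_indices k. (if \<beta> = \<alpha> then 1 else 0) * monomial \<beta> x)
        = (\<Sum>\<beta>\<in>multi_indices k. if \<alpha> = \<beta> then monomial \<beta> x else 0)"
      by (rule sum.cong) auto
    also have "\<dots> = monomial \<alpha> x"
      using \<alpha> by (simp only: sum.delta'[OF finite_multi_indices] if_True)
    finally show ?thesis by simp
  qed
  then show ?thesis
    unfolding homogeneous_iff by (intro exI[of _ "\<lambda>\<beta>. if \<beta> = \<alpha> then 1 else 0"] ext)
qed

lemma homogeneous_add:
  assumes "P \<in> homogeneous_polynomials k" "Q \<in> homogeneous_polynomials k"
  shows "(\<lambda>x. P x + Q x) \<in> homogeneous_polynomials k"
proof -
  obtain c d where "P = (\<lambda>x. \<Sum>\<alpha>\<in>multi_indices k. c \<alpha> * monomial \<alpha> x)" "Q = (\<lambda>x. \<Sum>\<alpha>\<in>multi_indices k. d \<alpha> * monomial \<alpha> x)"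
    using assms unfolding homogeneous_iff by auto
  then have "(\<lambda>x. P x + Q x) = (\<lambda>x. \<Sum>\<alpha>\<in>multi_indices k. (c \<alpha> + d \<alpha>) * monomial \<alpha> x)"
    by (simp add: sum.distrib distrib_right)
  then show ?thesis unfolding homogeneous_iff by (rule exI[of _ "\<lambda>\<alpha>. c \<alpha> + d \<alpha>"])
qed

lemma homogeneous_cmult:
  assumes "P \<in> homogeneous_polynomials k"
  shows "(\<lambda>x. a * P x) \<in> homogeneous_polynomials k"
proof -
  obtain c where "P = (\<lambda>x. \<Sum>\<alpha>\<in>multi_indices k. c \<alpha> * monomial \<alpha> x)"
    using assms unfolding homogeneous_iff by auto
  then have "(\<lambda>x. a * P x) = (\<lambda>x. \<Sum>\<alpha>\<in>multi_indices k. (a * c \<alpha>) * monomial \<alpha> x)"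
    by (simp add: sum_distrib_left mult.assoc)
  then show ?thesis unfolding homogeneous_iff by (rule exI[of _ "\<lambda>\<alpha>. a * c \<alpha>"])
qed

lemma homogeneous_sum:
  "(\<And>i. i \<in> I \<Longrightarrow> P i \<in> homogeneous_polynomials k) \<Longrightarrow> (\<lambda>x. \<Sum>i\<in>I. P i x) \<in> homogeneous_polynomials k"
  by (induction I rule: infinite_finite_induct) (auto intro: homogeneous_add homogeneous_zero)

lemma homogeneous_coord_mult:
  assumes "P \<in> homogeneous_polynomials k"
  shows "(\<lambda>x. complex_of_real (x $ j) * P x) \<in> homogeneous_polynomials (Suc k)"
proof -
  obtain c where P: "P = (\<lambda>x. \<Sum>\<alpha>\<in>multi_indices k. c \<alpha> * monomial \<alpha> x)"
    using assms unfolding homogeneous_iff by auto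
  have "monomial (\<alpha>(j := Suc (\<alpha> j))) \<in> homogeneous_polynomials (Suc k)" if "\<alpha> \<in> multi_indices k" for \<alpha>
  proof (rule homogeneous_monomial)
    have "(\<Sum>i\<in>UNIV. (\<alpha>(j := Suc (\<alpha> j))) i) = (\<Sum>i\<in>UNIV. \<alpha> i + (if i = j then 1 else 0))"
      by (rule sum.cong) auto
    then show "(\<Sum>i\<in>UNIV. (\<alpha>(j := Suc (\<alpha> j))) i) = Suc k"
      using that by (simp add: sum.distrib sum.delta multi_indices_def)
  qed
  then have "(\<lambda>x. \<Sum>\<alpha>\<in>multi_indices k. c \<alpha> * monomial (\<alpha>(j := Suc (\<alpha> j))) x) \<in> homogeneous_polynomials (Suc k)"
    by (intro homogeneous_sum homogeneous_cmult)
  moreover have "(\<lambda>x. complex_of_real (x $ j) * P x) = (\<lambda>x. \<Sum>\<alpha>\<in>multi_indices k. c \<alpha> * monomial (\<alpha>(j := Suc (\<alpha> j))) x)"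
    by (simp add: P sum_distrib_left coord_mult_monomial[symmetric] ac_simps)
  ultimately show ?thesis by simp
qed

lemma has_partial_homogeneous:
  assumes "P \<in> homogeneous_polynomials k"
  shows "has_partial i P (partial_derivative i P)"
proof -
  obtain c where P: "P = (\<lambda>x. \<Sum>\<alpha>\<in>multi_indices k. c \<alpha> * monomial \<alpha> x)"
    using assms unfolding homogeneous_iff by auto
  have "has_partial i P (\<lambda>x. \<Sum>\<alpha>\<in>multi_indices k. c \<alpha> * (of_nat (\<alpha> i) * monomial (\<alpha>(i := \<alpha> i - 1)) x))"
    unfolding P by (intro has_partial_sum has_partial_cmult has_partial_monomial)
  from this[folded partial_derivative_eq[OF this]] show ?thesis .
qed

lemma partial_derivative_homogeneous_eq:
  assumes "P = (\<lambda>x. \<Sum>\<alpha>\<in>A. c \<alpha> * monomial (h \<alpha>) x)"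
  shows "partial_derivative i P = (\<lambda>x. \<Sum>\<alpha>\<in>A. c \<alpha> * (of_nat (h \<alpha> i) * monomial ((h \<alpha>)(i := h \<alpha> i - 1)) x))"
  unfolding assms by (intro partial_derivative_eq has_partial_sum has_partial_cmult has_partial_monomial)

lemma partial_derivative_homogeneous:
  assumes "P \<in> homogeneous_polynomials k"
  shows "partial_derivative i P \<in> homogeneous_polynomials (k - 1)"
proof -
  obtain c where P: "P = (\<lambda>x. \<Sum>\<alpha>\<in>multi_indices k. c \<alpha> * monomial \<alpha> x)"
    using assms unfolding homogeneous_iff by auto
  have "(\<lambda>x. of_nat (\<alpha> i) * monomial (\<alpha>(i := \<alpha> i - 1)) x) \<in> homogeneous_polynomials (k - 1)" if "\<alpha> \<in> multi_indices k" for \<alpha>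
  proof (cases "\<alpha> i = 0")
    case False
    show ?thesis
    proof (intro homogeneous_cmult homogeneous_monomial)
      have "(\<Sum>j\<in>UNIV. \<alpha> j) = (\<Sum>j\<in>UNIV. (\<alpha>(i := \<alpha> i - 1)) j + (if j = i then 1 else 0))"
        using False by (intro sum.cong) auto
      then show "(\<Sum>j\<in>UNIV. (\<alpha>(i := \<alpha> i - 1)) j) = k - 1"
        using that by (simp add: sum.distrib sum.delta multi_indices_def)
    qed
  qed (simp add: homogeneous_zero)
  then have "(\<lambda>x. c \<alpha> * (of_nat (\<alpha> i) * monomial (\<alpha>(i := \<alpha> i - 1)) x)) \<in> homogeneous_polynomials (k - 1)"
    if "\<alpha> \<in> multi_indices k" for \<alpha>
    by (rule homogeneous_cmult) (use that in blast)
  then show ?thesis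
    unfolding partial_derivative_homogeneous_eq[OF P] by (rule homogeneous_sum)
qed

lemma partial_derivative_homogeneous_0:
  assumes "P \<in> homogeneous_polynomials 0"
  shows "partial_derivative i P = (\<lambda>x. 0)"
proof -
  obtain c where P: "P = (\<lambda>x. \<Sum>\<alpha>\<in>multi_indices 0. c \<alpha> * monomial \<alpha> x)"
    using assms unfolding homogeneous_iff by auto
  show ?thesis
    unfolding partial_derivative_homogeneous_eq[OF P] by (auto simp: multi_indices_def)
qed

lemma euler_homogeneous:
  assumes "P \<in> homogeneous_polynomials k"
  shows "(\<Sum>i\<in>UNIV. complex_of_real (x $ i) * partial_derivative i P x) = of_nat k * P x"
proof -
  obtain c where P: "P = (\<lambda>x. \<Sum>\<alpha>\<in>multi_indices k. c \<alpha> * monomial \<alpha> x)"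
    using assms unfolding homogeneous_iff by auto
  have *: "complex_of_real (x $ i) * (of_nat (\<alpha> i) * monomial (\<alpha>(i := \<alpha> i - 1)) x) = of_nat (\<alpha> i) * monomial \<alpha> x" for i \<alpha>
  proof (cases "\<alpha> i = 0")
    case False
    then have "(\<alpha>(i := \<alpha> i - 1))(i := Suc ((\<alpha>(i := \<alpha> i - 1)) i)) = \<alpha>" by simp
    with coord_mult_monomial[of x i "\<alpha>(i := \<alpha> i - 1)"]
    have "complex_of_real (x $ i) * monomial (\<alpha>(i := \<alpha> i - 1)) x = monomial \<alpha> x" by simp
    then show ?thesis by (simp only: mult.left_commute)
  qed simp
  have "(\<Sum>i\<in>UNIV. complex_of_real (x $ i) * partial_derivative i P x) =
     (\<Sum>i\<in>UNIV. \<Sum>\<alpha>\<in>multi_indices k. c \<alpha> * (complex_of_real (x $ i) * (of_nat (\<alpha> i) * monomial (\<alpha>(i := \<alpha> i - 1)) x)))"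
    unfolding partial_derivative_homogeneous_eq[OF P]
    by (simp only: sum_distrib_left) (simp only: mult.left_commute)
  also have "\<dots> = (\<Sum>\<alpha>\<in>multi_indices k. \<Sum>i\<in>UNIV. c \<alpha> * (of_nat (\<alpha> i) * monomial \<alpha> x))"
    unfolding * by (rule sum.swap)
  also have "\<dots> = (\<Sum>\<alpha>\<in>multi_indices k. of_nat k * (c \<alpha> * monomial \<alpha> x))"
  proof (rule sum.cong)
    fix \<alpha> :: "'a \<Rightarrow> nat" assume "\<alpha> \<in> multi_indices k"
    then have "(of_nat k :: complex) = (\<Sum>i\<in>UNIV. of_nat (\<alpha> i))"
      by (simp add: multi_indices_def of_nat_sum[symmetric])
    then show "(\<Sum>i\<in>UNIV. c \<alpha> * (of_nat (\<alpha> i) * monomial \<alpha> x)) = of_nat k * (c \<alpha> * monomial \<alpha> x)"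
      unfolding sum_distrib_right by (simp only: sum_distrib_right) (simp only: mult.left_commute)
  qed simp
  finally show ?thesis by (simp add: P sum_distrib_left)
qed

lemma partial_derivative_commute:
  assumes "P \<in> homogeneous_polynomials k"
  shows "partial_derivative j (partial_derivative i P) = partial_derivative i (partial_derivative j P)"
proof -
  obtain c where P: "P = (\<lambda>x. \<Sum>\<alpha>\<in>multi_indices k. c \<alpha> * monomial \<alpha> x)"
    using assms unfolding homogeneous_iff by auto
  have second: "partial_derivative b (partial_derivative a P) = (\<lambda>x. \<Sum>\<alpha>\<in>multi_indices k. (c \<alpha> * of_nat (\<alpha> a)) *
      (of_nat ((\<alpha>(a := \<alpha> a - 1)) b) * monomial ((\<alpha>(a := \<alpha> a - 1))(b := (\<alpha>(a := \<alpha> a - 1)) b - 1)) x))" for a b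
    by (rule partial_derivative_homogeneous_eq[where h="\<lambda>\<alpha>. \<alpha>(a := \<alpha> a - 1)"])
       (simp only: partial_derivative_homogeneous_eq[OF P] mult.assoc)
  show ?thesis
  proof (cases "i = j")
    case False
    show ?thesis
    proof -
      have "(\<alpha>(i := a))(j := b) = (\<alpha>(j := b))(i := a)" for \<alpha> :: "'a \<Rightarrow> nat" and a b
        using False by (simp add: fun_upd_twist)
      moreover have "(\<alpha>(i := a)) j = \<alpha> j" "(\<alpha>(j := a)) i = \<alpha> i" for \<alpha> :: "'a \<Rightarrow> nat" and a
        using False by simp_all
      ultimately show ?thesis
        unfolding second by (simp only: mult.assoc) (simp only: mult.left_commute)
    qed
  qed simp
qed

lemma continuous_on_homogeneous:
  fixes P :: "real ^ 'a::finite \<Rightarrow> complex"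
  shows "P \<in> homogeneous_polynomials k \<Longrightarrow> continuous_on UNIV P"
proof -
  have "continuous_on UNIV (\<lambda>x::real ^ 'a. \<Sum>\<alpha>\<in>multi_indices k. c \<alpha> * monomial \<alpha> x)" for c
    unfolding monomial_def by (intro continuous_intros)
  then show "P \<in> homogeneous_polynomials k \<Longrightarrow> continuous_on UNIV P"
    unfolding homogeneous_iff by blast
qed

section \<open>Raising the degree of a solid harmonic\<close>

lemma poly_growth_homogeneous:
  fixes P :: "real ^ 'n::finite \<Rightarrow> complex"
  assumes "P \<in> homogeneous_polynomials k"
  shows "poly_growth P"
proof -
  have prod: "poly_growth (\<lambda>x. \<Prod>i\<in>I. F i x)" if "\<And>i. i \<in> I \<Longrightarrow> poly_growth (F i)"
    for I :: "'n set" and F :: "'n \<Rightarrow> real ^ 'n \<Rightarrow> complex"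
    using that by (induction I rule: infinite_finite_induct) (auto intro: poly_growth_mult poly_growth_const)
  have pow: "poly_growth (\<lambda>x::real ^ 'n. complex_of_real (x $ i) ^ m)" for i :: 'n and m
    by (induction m) (auto intro: poly_growth_mult poly_growth_nth poly_growth_const)
  have mon: "monomial \<alpha> = (\<lambda>x::real ^ 'n. \<Prod>i\<in>UNIV. complex_of_real (x $ i) ^ \<alpha> i)" for \<alpha> :: "'n \<Rightarrow> nat"
    by (simp add: fun_eq_iff monomial_def)
  obtain c where P: "P = (\<lambda>x. \<Sum>\<alpha>\<in>multi_indices k. c \<alpha> * monomial \<alpha> x)"
    using assms unfolding homogeneous_iff by auto
  show ?thesis
    unfolding P mon by (intro poly_growth_sum poly_growth_mult poly_growth_const prod pow)
qed

lemma solid_harmonicsD: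
  assumes "S \<in> solid_harmonics l"
  shows "S \<in> homogeneous_polynomials l" "(\<Sum>j\<in>UNIV. partial_derivative j (partial_derivative j S) x) = 0"
  using assms by (auto simp: solid_harmonics_def laplacian_def)

text \<open>Partial derivatives of a harmonic polynomial are harmonic, since partial derivatives commute.\<close>

lemma laplacian_partial_derivative:
  assumes "S \<in> solid_harmonics l"
  shows "(\<Sum>j\<in>UNIV. partial_derivative j (partial_derivative j (partial_derivative i S)) x) = 0"
proof -
  note S = solid_harmonicsD(1)[OF assms]
  note dS = partial_derivative_homogeneous[OF S]
  note ddS = partial_derivative_homogeneous[OF dS]
  have "partial_derivative j (partial_derivative j (partial_derivative i S)) =
      partial_derivative i (partial_derivative j (partial_derivative j S))" for j
    by (simp only: partial_derivative_commute[OF S, of j i] partial_derivative_commute[OF dS, of j i j])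
  moreover have "has_partial i (\<lambda>x. \<Sum>j\<in>UNIV. partial_derivative j (partial_derivative j S) x)
      (\<lambda>x. \<Sum>j\<in>UNIV. partial_derivative i (partial_derivative j (partial_derivative j S)) x)"
    by (intro has_partial_sum has_partial_homogeneous[OF ddS])
  then have "(\<lambda>x. \<Sum>j\<in>UNIV. partial_derivative i (partial_derivative j (partial_derivative j S)) x) = (\<lambda>x. 0)"
    unfolding solid_harmonicsD(2)[OF assms]
    by (rule trans[OF partial_derivative_eq[symmetric] partial_derivative_eq[OF has_partial_const]])
  ultimately show ?thesis by (simp only: fun_eq_iff)
qed

text \<open>Up to a factor, the part of \<open>y\<^sub>i S\<close> in \<open>H\<^sub>l\<^sub>+\<^sub>1\<close>. The denominator is \<open>0\<close> exactly for \<open>n = 2\<close> and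
\<open>l = 0\<close> (when \<open>n \<ge> 2\<close>). Then \<open>S\<close> is constant and the second term is absent, in agreement with the
convention that the quotient by \<open>0\<close> is \<open>0\<close>.\<close>

definition raised_harmonic :: "nat \<Rightarrow> (real ^ 'n::finite \<Rightarrow> complex) \<Rightarrow> 'n \<Rightarrow> real ^ 'n \<Rightarrow> complex" where
  "raised_harmonic l S i y = complex_of_real (y $ i) * S y
     - 1 / (of_nat CARD('n) + 2 * of_nat l - 2) * (complex_of_real (y \<bullet> y) * partial_derivative i S y)"

definition raising_constant :: "'n::finite itself \<Rightarrow> nat \<Rightarrow> complex" where
  "raising_constant _ l = 1 - of_nat l / (of_nat CARD('n) + 2 * of_nat l - 2)"

lemma sum_coord_square: "(\<Sum>i\<in>UNIV. complex_of_real (y $ i) * complex_of_real (y $ i)) = complex_of_real (y \<bullet> y)"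
  by (simp add: inner_vec_def)

lemma raising_denominator_nonzero:
  assumes "CARD('n::finite) \<ge> 2" "l > 0"
  shows "of_nat CARD('n) + 2 * of_nat l - 2 \<noteq> (0::complex)"
proof -
  have "of_nat CARD('n) + 2 * of_nat l - 2 = (of_nat (CARD('n) + 2 * l - 2) :: complex)"
    using assms by (simp add: of_nat_diff)
  then show ?thesis using assms by (simp only: of_nat_eq_0_iff)
qed

text \<open>Away from the degenerate case the constant is \<open>(n + l - 2) / (n + 2l - 2)\<close>.\<close>

lemma raising_constant_nonzero:
  assumes "CARD('n::finite) \<ge> 2"
  shows "raising_constant TYPE('n) l \<noteq> 0"
proof (cases "l = 0")
  case False
  have "of_nat (CARD('n) + l - 2) \<noteq> (0::complex)"
    using assms False by (simp only: of_nat_eq_0_iff)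
  moreover have "of_nat (CARD('n) + l - 2) = (of_nat CARD('n) + 2 * of_nat l - 2) - (of_nat l :: complex)"
    using assms by (simp add: of_nat_diff)
  ultimately show ?thesis
    using raising_denominator_nonzero[of l, where 'n='n] assms False
    by (simp add: raising_constant_def field_simps)
qed (simp add: raising_constant_def)

lemma has_partial_raised_harmonic:
  fixes S :: "real ^ 'n::finite \<Rightarrow> complex"
  assumes "S \<in> homogeneous_polynomials l"
  shows "has_partial j (raised_harmonic l S i) (\<lambda>y. (if j = i then 1 else 0) * S y + complex_of_real (y $ i) * partial_derivative j S y
      - 1 / (of_nat CARD('n) + 2 * of_nat l - 2) *
        (2 * complex_of_real (y $ j) * partial_derivative i S y + complex_of_real (y \<bullet> y) * partial_derivative j (partial_derivative i S) y))"
  unfolding raised_harmonic_def[abs_def]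
  by (intro has_partial_diff has_partial_mult[OF has_partial_coord] has_partial_cmult has_partial_mult[OF has_partial_norm_sq]
      has_partial_homogeneous[OF assms] has_partial_homogeneous[OF partial_derivative_homogeneous[OF assms]])

lemma raised_harmonic_homogeneous:
  fixes S :: "real ^ 'n::finite \<Rightarrow> complex"
  assumes "S \<in> homogeneous_polynomials l"
  shows "raised_harmonic l S i \<in> homogeneous_polynomials (Suc l)"
proof -
  have "(\<lambda>y. complex_of_real (y \<bullet> y) * partial_derivative i S y) \<in> homogeneous_polynomials (Suc l)"
  proof (cases l)
    case 0
    then show ?thesis
      using partial_derivative_homogeneous_0[of S i] assms by (simp add: homogeneous_zero)
  next
    case (Suc m)
    have "(\<lambda>y. \<Sum>j\<in>UNIV. complex_of_real (y $ j) * (complex_of_real (y $ j) * partial_derivative i S y)) \<in> homogeneous_polynomials (Suc (Suc (l - 1)))"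
      by (intro homogeneous_sum homogeneous_coord_mult partial_derivative_homogeneous assms)
    then show ?thesis
      by (simp only: mult.assoc[symmetric] sum_distrib_right[symmetric] sum_coord_square) (simp add: Suc)
  qed
  from homogeneous_add[OF homogeneous_coord_mult[OF assms, of i] homogeneous_cmult[OF this, of "- (1 / (of_nat CARD('n) + 2 * of_nat l - 2))"]]
  show ?thesis
    unfolding raised_harmonic_def[abs_def] by (simp only: mult_minus_left add_uminus_conv_diff)
qed

text \<open>With \<open>D = n + 2l - 2\<close>, Euler's identity for \<open>\<partial>\<^sub>i S\<close> gives
\<open>\<Delta>(y\<^sub>i S) = 2 \<partial>\<^sub>i S\<close> and \<open>\<Delta>(|y|\<^sup>2 \<partial>\<^sub>i S) = (2n + 4(l - 1)) \<partial>\<^sub>i S = 2 D \<partial>\<^sub>i S\<close>.\<close>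

lemma raised_harmonic_harmonic:
  fixes S :: "real ^ 'n::finite \<Rightarrow> complex"
  assumes n: "CARD('n) \<ge> 2" and S: "S \<in> solid_harmonics l"
  shows "raised_harmonic l S i \<in> solid_harmonics (Suc l)"
proof -
  note h = solid_harmonicsD(1)[OF S]
  note dh = partial_derivative_homogeneous[OF h]
  note ddh = partial_derivative_homogeneous[OF dh]
  let ?d = "\<lambda>j. partial_derivative j S" and ?D = "of_nat CARD('n) + 2 * of_nat l - 2 :: complex"
  have "laplacian (raised_harmonic l S i) y = 0" for y
  proof -
    have second: "partial_derivative j (partial_derivative j (raised_harmonic l S i)) =
      (\<lambda>y. ((if j = i then 1 else 0) * ?d j y +
            ((if j = i then 1 else 0) * ?d j y + complex_of_real (y $ i) * partial_derivative j (?d j) y))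
        - 1 / ?D * ((2 * (if j = j then 1 else 0) * ?d i y + 2 * complex_of_real (y $ j) * partial_derivative j (?d i) y)
            + (2 * complex_of_real (y $ j) * partial_derivative j (?d i) y
               + complex_of_real (y \<bullet> y) * partial_derivative j (partial_derivative j (?d i)) y)))" for j
      unfolding partial_derivative_eq[OF has_partial_raised_harmonic[OF h]]
      by (intro partial_derivative_eq has_partial_diff has_partial_add has_partial_cmult has_partial_mult
          has_partial_coord has_partial_norm_sq has_partial_homogeneous[OF h] has_partial_homogeneous[OF dh] has_partial_homogeneous[OF ddh])
    have "laplacian (raised_harmonic l S i) y =
      2 * ?d i y + complex_of_real (y $ i) * (\<Sum>j\<in>UNIV. partial_derivative j (?d j) y)
      - 1 / ?D * (2 * of_nat CARD('n) * ?d i y + 4 * (\<Sum>j\<in>UNIV. complex_of_real (y $ j) * partial_derivative j (?d i) y)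
        + complex_of_real (y \<bullet> y) * (\<Sum>j\<in>UNIV. partial_derivative j (partial_derivative j (?d i)) y))"
      unfolding laplacian_def second sum_subtractf sum.distrib sum_distrib_left[symmetric]
      by (simp add: sum.distrib sum_distrib_left[symmetric] mult.assoc if_distrib[of "\<lambda>c. c * _"] sum.delta cong: if_cong)
    also have "\<dots> = 2 * ?d i y - 1 / ?D * (2 * of_nat CARD('n) * ?d i y + 4 * (of_nat (l - 1) * ?d i y))"
      unfolding solid_harmonicsD(2)[OF S] laplacian_partial_derivative[OF S] euler_homogeneous[OF dh] by simp
    also have "\<dots> = 0"
    proof (cases "l = 0")
      case True
      then show ?thesis using partial_derivative_homogeneous_0[of S i] h by simp
    next
      case False
      have "of_nat (l - 1) = (of_nat l - 1 :: complex)" using False by (simp add: of_nat_diff)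
      have "2 * of_nat CARD('n) * ?d i y + 4 * (of_nat (l - 1) * ?d i y) = ?D * (2 * ?d i y)"
        unfolding \<open>of_nat (l - 1) = _\<close> by (simp add: algebra_simps)
      then show ?thesis
        using raising_denominator_nonzero[of l, where 'n='n] n False by simp
    qed
    finally show ?thesis .
  qed
  then show ?thesis
    using raised_harmonic_homogeneous[OF h] by (simp add: solid_harmonics_def)
qed

text \<open>Euler's identity for \<open>S\<close>.\<close>

lemma radial_component_raised_harmonic:
  fixes S :: "real ^ 'n::finite \<Rightarrow> complex"
  assumes "S \<in> homogeneous_polynomials l"
  shows "(\<Sum>i\<in>UNIV. complex_of_real (y $ i) * raised_harmonic l S i y) = raising_constant TYPE('n) l * (complex_of_real (y \<bullet> y) * S y)"
proof -
  let ?D = "of_nat CARD('n) + 2 * of_nat l - 2 :: complex"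
  have "(\<Sum>i\<in>UNIV. complex_of_real (y $ i) * raised_harmonic l S i y) =
     (\<Sum>i\<in>UNIV. complex_of_real (y $ i) * complex_of_real (y $ i)) * S y
     - 1 / ?D * (complex_of_real (y \<bullet> y) * (\<Sum>i\<in>UNIV. complex_of_real (y $ i) * partial_derivative i S y))"
    unfolding raised_harmonic_def right_diff_distrib sum_subtractf sum_distrib_left sum_distrib_right
    by (simp only: mult.assoc) (simp only: mult.left_commute)
  then show ?thesis
    unfolding sum_coord_square euler_homogeneous[OF assms] raising_constant_def by (simp add: algebra_simps)
qed

text \<open>The constant is the one of the radial component, up to the factor \<open>n + 2l\<close>. Hence, after
multiplication of the field by a radial function, the divergence is \<open>S\<close> times an Euler operator
applied to that function.\<close>

lemma divergence_raised_harmonic: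
  fixes S :: "real ^ 'n::finite \<Rightarrow> complex"
  assumes n: "CARD('n) \<ge> 2" and S: "S \<in> solid_harmonics l"
  shows "(\<Sum>i\<in>UNIV. partial_derivative i (raised_harmonic l S i) y) =
     of_nat (CARD('n) + 2 * l) * (raising_constant TYPE('n) l * S y)"
proof -
  note h = solid_harmonicsD(1)[OF S]
  let ?D = "of_nat CARD('n) + 2 * of_nat l - 2 :: complex"
  have "(\<Sum>i\<in>UNIV. partial_derivative i (raised_harmonic l S i) y) =
     of_nat CARD('n) * S y + of_nat l * S y - 1 / ?D * (2 * (of_nat l * S y))"
    unfolding partial_derivative_eq[OF has_partial_raised_harmonic[OF h]] sum_subtractf sum.distrib
      sum_distrib_left[symmetric] mult.assoc solid_harmonicsD(2)[OF S] euler_homogeneous[OF h]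
    by simp
  also have "\<dots> = of_nat (CARD('n) + 2 * l) * (raising_constant TYPE('n) l * S y)"
  proof (cases "l = 0")
    case False
    have "?D * (1 / ?D) = 1"
      using raising_denominator_nonzero[of l, where 'n='n] n False by simp
    moreover have "(of_nat CARD('n) + 2 * of_nat l) * (1 / ?D) = ?D * (1 / ?D) + 2 * (1 / ?D)"
      unfolding distrib_right[symmetric] by simp
    ultimately have "(of_nat CARD('n) + 2 * of_nat l) * (1 / ?D) = 1 + 2 * (1 / ?D)"
      by (simp only:)
    then have "of_nat CARD('n) + of_nat l - 1 / ?D * (2 * of_nat l) =
        (of_nat CARD('n) + 2 * of_nat l) - ((of_nat CARD('n) + 2 * of_nat l) * (1 / ?D)) * of_nat l"
      by (simp only: ring_distribs) simp
    also have "\<dots> = of_nat (CARD('n) + 2 * l) * raising_constant TYPE('n) l"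
      by (simp add: raising_constant_def algebra_simps)
    finally have *: "of_nat CARD('n) + of_nat l - 1 / ?D * (2 * of_nat l) = of_nat (CARD('n) + 2 * l) * raising_constant TYPE('n) l" .
    have "of_nat CARD('n) * S y + of_nat l * S y - 1 / ?D * (2 * (of_nat l * S y)) =
        (of_nat CARD('n) + of_nat l - 1 / ?D * (2 * of_nat l)) * S y"
      by (simp only: left_diff_distrib distrib_right mult.assoc)
    then show ?thesis
      unfolding * by (simp only: mult.assoc)
  qed (simp add: raising_constant_def)
  finally show ?thesis .
qed

section \<open>Radial weights and the Euler equation\<close>

text \<open>The weights, as functions of \<open>q = |y|\<^sup>2\<close> and not of \<open>|y|\<close>, so that the chain rule needs no
exception at the origin. Growth at infinity is permitted because the class has to be closed under
taking primitives.\<close>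

definition admissible :: "real \<Rightarrow> (real \<Rightarrow> real) \<Rightarrow> bool" where
  "admissible \<rho> u \<longleftrightarrow> continuous_on UNIV u \<and> poly_growth u \<and> (\<forall>q\<le>\<rho>. u q = 0)"

lemma has_derivative_integral_from_0:
  fixes v :: "real \<Rightarrow> real"
  assumes "continuous_on UNIV v" "q > 0"
  shows "((\<lambda>q. integral {0..q} v) has_real_derivative v q) (at q)"
proof -
  have "((\<lambda>q. integral {0..q} v) has_vector_derivative v q) (at q within {0..q + 1})"
    using assms by (intro integral_has_vector_derivative) (auto intro: continuous_on_subset)
  then show ?thesis
    using assms(2) by (simp add: has_real_derivative_iff_has_vector_derivative at_within_Icc_at)
qed

text \<open>The primitive is normalized to vanish at \<open>0\<close>; it then vanishes wherever \<open>v\<close> has not started yet.\<close>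

lemma admissible_primitive:
  assumes v: "admissible \<rho> v" and \<rho>: "\<rho> > 0"
  obtains W where "admissible \<rho> W" "\<And>q. (W has_real_derivative v q) (at q)"
proof
  define W where "W = (\<lambda>q. integral {0..q} v)"
  have cont: "continuous_on UNIV v" and zero: "\<And>q. q \<le> \<rho> \<Longrightarrow> v q = 0"
    using v by (auto simp: admissible_def)
  have W0: "W q = 0" if "q \<le> \<rho>" for q
  proof -
    have "integral {0..q} v = integral {0..q} (\<lambda>_. 0)"
      by (rule integral_cong) (use that zero in auto)
    then show ?thesis by (simp add: W_def)
  qed
  show deriv: "(W has_real_derivative v q) (at q)" for q
  proof (cases "q > 0")
    case True
    then show ?thesis unfolding W_def by (rule has_derivative_integral_from_0[OF cont])
  next
    case False
    have "((\<lambda>_. 0) has_real_derivative 0) (at q)" by simp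
    moreover have "\<forall>\<^sub>F x in nhds q. 0 = W x"
      using eventually_nhds_in_open[of "{..<\<rho>}" q] False \<rho>
      by (auto elim!: eventually_mono simp: W0)
    ultimately have "(W has_real_derivative 0) (at q)"
      using DERIV_cong_ev[of q q "\<lambda>_. 0" W 0 0] by simp
    then show ?thesis using zero[of q] False \<rho> by simp
  qed
  have "continuous_on UNIV W"
    using deriv by (intro continuous_at_imp_continuous_on ballI DERIV_isCont)
  moreover have "poly_growth W"
  proof -
    obtain C N where CN: "C \<ge> 0" "\<And>q. norm (v q) \<le> C * (1 + norm q) ^ N"
      using v unfolding admissible_def by (metis poly_growthE)
    show ?thesis
    proof (rule poly_growthI)
      fix q :: real
      show "norm (W q) \<le> C * (1 + norm q) ^ Suc N"
      proof (cases "q \<ge> 0")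
        case True
        have "norm (integral (cbox 0 q) v) \<le> C * (1 + q) ^ N * measure lborel (cbox 0 q)"
        proof (rule has_integral_bound)
          show "0 \<le> C * (1 + q) ^ N" using CN(1) True by simp
          show "(v has_integral integral (cbox 0 q) v) (cbox 0 q)"
            by (intro integrable_integral integrable_continuous continuous_on_subset[OF cont]) simp
          fix s assume "s \<in> cbox 0 q"
          then have "C * (1 + norm s) ^ N \<le> C * (1 + q) ^ N"
            by (intro mult_left_mono power_mono CN(1)) auto
          with CN(2)[of s] show "norm (v s) \<le> C * (1 + q) ^ N" by linarith
        qed
        also have "\<dots> \<le> C * (1 + q) ^ N * (1 + q)"
          using True CN(1) by (intro mult_left_mono) auto
        finally show ?thesis
          using True by (simp add: W_def ac_simps)
      next
        case False
        then show ?thesis using W0[of q] \<rho> CN(1) by simp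
      qed
    qed
  qed
  ultimately show "admissible \<rho> W" using W0 by (simp add: admissible_def)
qed

text \<open>The solution of \<open>a h + q h' = u\<close> is \<open>h(q) = q\<^sup>-\<^sup>a \<integral> s\<^sup>a\<^sup>-\<^sup>1 u(s) ds\<close> with the integral over \<open>[0, q]\<close>.
Wherever a power of \<open>q\<close> meets a factor that vanishes for \<open>q \<le> \<rho>\<close>, the base may be replaced by
\<open>max q \<rho>\<close>, which keeps the power continuous on the whole line.\<close>

lemma admissible_euler_ode:
  assumes u: "admissible \<rho> u" and \<rho>: "\<rho> > 0" and a: "a \<ge> 1"
  obtains h h' where "admissible \<rho> h" "admissible \<rho> h'" "\<And>q. (h has_real_derivative h' q) (at q)"
    "\<And>q. a * h q + q * h' q = u q"
proof -
  have cu: "continuous_on UNIV u" and gu: "poly_growth u" and zu: "\<And>q. q \<le> \<rho> \<Longrightarrow> u q = 0"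
    using u by (auto simp: admissible_def)
  have "admissible \<rho> (\<lambda>q. max q \<rho> powr (a - 1) * u q)"
    unfolding admissible_def
  proof (intro conjI)
    show "continuous_on UNIV (\<lambda>q. max q \<rho> powr (a - 1) * u q)"
      using \<rho> by (intro continuous_intros cu) auto
    have "poly_growth (\<lambda>q. max q \<rho> powr (a - 1))"
    proof (rule poly_growthI)
      fix q :: real
      have "max q \<rho> \<le> (1 + \<rho>) * (1 + \<bar>q\<bar>)"
      proof -
        have "(1 + \<rho>) * (1 + \<bar>q\<bar>) = 1 + \<rho> + \<bar>q\<bar> + \<rho> * \<bar>q\<bar>" by (simp add: algebra_simps)
        moreover have "\<rho> * \<bar>q\<bar> \<ge> 0" using \<rho> by simp
        ultimately show ?thesis using \<rho> by linarith
      qed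
      then have "max q \<rho> powr (a - 1) \<le> ((1 + \<rho>) * (1 + \<bar>q\<bar>)) powr (a - 1)"
        using a \<rho> by (intro powr_mono2) auto
      also have "\<dots> \<le> ((1 + \<rho>) * (1 + \<bar>q\<bar>)) powr real (nat \<lceil>a\<rceil>)"
      proof (rule powr_mono)
        show "a - 1 \<le> real (nat \<lceil>a\<rceil>)" using a by linarith
        have "1 * 1 \<le> (1 + \<rho>) * (1 + \<bar>q\<bar>)" using \<rho> by (intro mult_mono) auto
        then show "1 \<le> (1 + \<rho>) * (1 + \<bar>q\<bar>)" by simp
      qed
      also have "\<dots> = ((1 + \<rho>) * (1 + \<bar>q\<bar>)) ^ nat \<lceil>a\<rceil>"
        using \<rho> by (intro powr_realpow mult_pos_pos) auto
      finally show "norm (max q \<rho> powr (a - 1)) \<le> (1 + \<rho>) ^ nat \<lceil>a\<rceil> * (1 + norm q) ^ nat \<lceil>a\<rceil>"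
        by (simp add: power_mult_distrib)
    qed
    then show "poly_growth (\<lambda>q. max q \<rho> powr (a - 1) * u q)" by (rule poly_growth_mult[OF _ gu])
  qed (simp add: zu)
  then obtain W where W: "admissible \<rho> W" and dW: "\<And>q. (W has_real_derivative max q \<rho> powr (a - 1) * u q) (at q)"
    using \<rho> by (rule admissible_primitive) blast
  have zW: "\<And>q. q \<le> \<rho> \<Longrightarrow> W q = 0" using W by (auto simp: admissible_def)
  define h where "h = (\<lambda>q. max q \<rho> powr (- a) * W q)"
  define h' where "h' = (\<lambda>q. (u q - a * h q) * (1 / max q \<rho>))"
  have h: "admissible \<rho> h"
    unfolding admissible_def
  proof (intro conjI)
    show "continuous_on UNIV h"
      unfolding h_def using \<rho> W by (intro continuous_intros) (auto simp: admissible_def)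
    have "max q \<rho> powr (- a) \<le> \<rho> powr (- a)" for q
      using a \<rho> by (intro powr_mono2') auto
    then have "poly_growth (\<lambda>q. max q \<rho> powr (- a))"
      by (intro poly_growth_bounded[where C="\<rho> powr (- a)"]) simp
    then show "poly_growth h"
      unfolding h_def using W by (intro poly_growth_mult) (auto simp: admissible_def)
  qed (simp add: h_def zW)
  have zh: "\<And>q. q \<le> \<rho> \<Longrightarrow> h q = 0" using h by (auto simp: admissible_def)
  have h': "admissible \<rho> h'"
    unfolding admissible_def
  proof (intro conjI)
    show "continuous_on UNIV h'"
      unfolding h'_def using \<rho> h cu by (intro continuous_intros) (auto simp: admissible_def)
    have "poly_growth (\<lambda>q. 1 / max q \<rho>)"
      using \<rho> by (intro poly_growth_bounded[where C="1 / \<rho>"]) (simp add: frac_le)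
    then show "poly_growth h'"
      unfolding h'_def using h by (intro poly_growth_mult poly_growth_diff gu poly_growth_const) (auto simp: admissible_def)
  qed (simp add: h'_def zh zu)
  have ode: "a * h q + q * h' q = u q" for q
  proof (cases "q \<le> \<rho>")
    case True
    then show ?thesis by (simp add: h'_def zh zu)
  next
    case False
    then show ?thesis using \<rho> by (simp add: h'_def max_def)
  qed
  have deriv: "(h has_real_derivative h' q) (at q)" for q
  proof (cases "q > 0")
    case True
    have hq: "h s = s powr (- a) * W s" for s
      by (cases "s \<le> \<rho>") (auto simp: h_def zW max_def)
    \<comment> \<open>the derivative of the primitive, times the integrating factor\<close>
    have vq: "q powr (- a) * (max q \<rho> powr (a - 1) * u q) = u q / q"
    proof (cases "q \<le> \<rho>")
      case False
      have "q powr (- a) * q powr (a - 1) = q powr (- 1)"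
        by (simp add: powr_add[symmetric])
      then have "q powr (- a) * q powr (a - 1) = 1 / q"
        using True by (simp add: powr_minus_divide)
      with False show ?thesis by (simp add: max_def mult.assoc[symmetric])
    qed (simp add: zu)
    have "((\<lambda>s. s powr (- a) * W s) has_real_derivative
        (- a * q powr (- a - 1)) * W q + (max q \<rho> powr (a - 1) * u q) * q powr (- a)) (at q)"
      by (intro DERIV_mult has_real_derivative_powr True dW)
    moreover have "(- a * q powr (- a - 1)) * W q + (max q \<rho> powr (a - 1) * u q) * q powr (- a) = h' q"
    proof -
      have "q powr (- a - 1) = q powr (- a) / q"
        using True by (simp add: powr_diff)
      then have "(- a * q powr (- a - 1)) * W q + (max q \<rho> powr (a - 1) * u q) * q powr (- a) = - a * h q / q + u q / q"
        using vq by (simp add: hq mult.commute mult.left_commute)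
      also have "\<dots> = h' q"
        using ode[of q] True by (simp add: field_simps)
      finally show ?thesis .
    qed
    ultimately show ?thesis unfolding hq[abs_def] by simp
  next
    case False
    have "((\<lambda>_. 0) has_real_derivative 0) (at q)" by simp
    moreover have "\<forall>\<^sub>F x in nhds q. 0 = h x"
      using eventually_nhds_in_open[of "{..<\<rho>}" q] False \<rho>
      by (auto elim!: eventually_mono simp: zh)
    ultimately have "(h has_real_derivative 0) (at q)"
      using DERIV_cong_ev[of q q "\<lambda>_. 0" h 0 0] by simp
    then show ?thesis using h' False \<rho> by (simp add: admissible_def)
  qed
  show thesis by (rule that[OF h h' deriv ode])
qed

lemma continuous_on_radial:
  assumes "continuous_on UNIV u"
  shows "continuous_on UNIV (\<lambda>y::real ^ 'n::finite. complex_of_real (u (y \<bullet> y)))"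
proof -
  have "continuous_on UNIV (\<lambda>y::real ^ 'n. y \<bullet> y)" by (intro continuous_intros)
  then have "continuous_on UNIV (\<lambda>y::real ^ 'n. u (y \<bullet> y))"
    by (rule continuous_on_compose2[OF assms]) simp
  then show ?thesis by (rule continuous_on_of_real)
qed

section \<open>Differentiation under the integral sign\<close>

lemma integrable_rapid_kernel:
  fixes f K :: "real ^ 'n::finite \<Rightarrow> complex"
  assumes f: "continuous_on UNIV f" "rapidly_decreasing f" and K: "continuous_on UNIV K" "poly_growth K"
  shows "integrable lborel (\<lambda>y. f (x + y) * K y)"
proof (rule integrable_rapidly_decreasing)
  show "rapidly_decreasing (\<lambda>y. f (x + y) * K y)"
    by (intro rapidly_decreasing_mult rapidly_decreasing_translate f K)
  have "continuous_on UNIV (\<lambda>y. f (x + y) * K y)"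
    by (intro continuous_intros K(1) continuous_on_compose2[OF f(1)]) auto
  then show "(\<lambda>y. f (x + y) * K y) \<in> borel_measurable borel"
    by (rule borel_measurable_continuous_onI)
qed

lemma has_partial_increment_bound:
  assumes "has_partial i K K'" "\<And>s. 0 < s \<Longrightarrow> s < \<tau> \<Longrightarrow> norm (K' (z + s *\<^sub>R axis i 1)) \<le> M" "\<tau> > 0"
  shows "norm (K (z + \<tau> *\<^sub>R axis i 1) - K z) \<le> \<tau> * M"
proof -
  note d = has_partial_shift[OF assms(1), of z]
  have "\<exists>s\<in>{0<..<\<tau>}. norm (K (z + \<tau> *\<^sub>R axis i 1) - K (z + 0 *\<^sub>R axis i 1)) \<le> norm ((\<tau> - 0) *\<^sub>R K' (z + s *\<^sub>R axis i 1))"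
  proof (rule mvt_general[OF assms(3)])
    show "continuous_on {0..\<tau>} (\<lambda>t. K (z + t *\<^sub>R axis i 1))"
      using d by (intro continuous_at_imp_continuous_on ballI has_vector_derivative_continuous)
    show "((\<lambda>t. K (z + t *\<^sub>R axis i 1)) has_derivative (\<lambda>h. h *\<^sub>R K' (z + s *\<^sub>R axis i 1))) (at s)" for s
      using d[of s] by (simp add: has_vector_derivative_def)
  qed
  then obtain s where "0 < s" "s < \<tau>" "norm (K (z + \<tau> *\<^sub>R axis i 1) - K z) \<le> \<tau> * norm (K' (z + s *\<^sub>R axis i 1))"
    using assms(3) by auto
  then show ?thesis
    using assms(2)[of s] assms(3) by (meson mult_left_mono less_imp_le order_trans)
qed

lemma has_partial_quotient_tendsto:
  assumes "has_partial i K K'" "\<tau> \<longlonglongrightarrow> 0" "\<And>m. \<tau> m \<noteq> (0::real)"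
  shows "(\<lambda>m. (K (z + \<tau> m *\<^sub>R axis i 1) - K z) / complex_of_real (\<tau> m)) \<longlonglongrightarrow> K' z"
proof -
  have "((\<lambda>t. K (z + t *\<^sub>R axis i 1)) has_derivative (\<lambda>h. h *\<^sub>R K' z)) (at 0)"
    using assms(1) by (simp add: has_partial_def has_vector_derivative_def)
  then have "(\<lambda>h. norm (K (z + h *\<^sub>R axis i 1) - K z - h *\<^sub>R K' z) / norm h) \<midarrow>0\<rightarrow> 0"
    by (simp add: has_derivative_at)
  moreover have "filterlim \<tau> (at 0) sequentially"
    using assms(2,3) by (auto simp: filterlim_at)
  ultimately have "(\<lambda>m. norm (K (z + \<tau> m *\<^sub>R axis i 1) - K z - \<tau> m *\<^sub>R K' z) / norm (\<tau> m)) \<longlonglongrightarrow> 0"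
    by (rule filterlim_compose)
  moreover have "norm (K (z + \<tau> m *\<^sub>R axis i 1) - K z - \<tau> m *\<^sub>R K' z) / norm (\<tau> m) =
     norm ((K (z + \<tau> m *\<^sub>R axis i 1) - K z) / complex_of_real (\<tau> m) - K' z)" for m
  proof -
    have "(K (z + \<tau> m *\<^sub>R axis i 1) - K z) / complex_of_real (\<tau> m) - K' z =
        (K (z + \<tau> m *\<^sub>R axis i 1) - K z - \<tau> m *\<^sub>R K' z) / complex_of_real (\<tau> m)"
      using assms(3)[of m] by (simp add: diff_divide_distrib scaleR_conv_of_real)
    then show ?thesis by (simp add: norm_divide)
  qed
  ultimately have "(\<lambda>m. norm ((K (z + \<tau> m *\<^sub>R axis i 1) - K z) / complex_of_real (\<tau> m) - K' z)) \<longlonglongrightarrow> 0"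
    by (simp only:)
  then show ?thesis
    by (simp only: tendsto_norm_zero_iff LIM_zero_iff)
qed

text \<open>A translation of the variable of integration moves the increment in \<open>x\<close> to the kernel. The
difference quotients of the kernel have polynomial growth uniformly in the increment, by the mean
value inequality, so the rapid decrease of \<open>f\<close> permits dominated convergence.\<close>

lemma integral_partial_eq_0:
  fixes f K K' :: "real ^ 'n::finite \<Rightarrow> complex"
  assumes f: "continuous_on UNIV f" "rapidly_decreasing f"
    and K: "continuous_on UNIV K" "poly_growth K" and K': "continuous_on UNIV K'" "poly_growth K'"
    and partial: "has_partial i K K'" and e: "e > 0"
    and zero: "\<And>t. \<bar>t\<bar> < e \<Longrightarrow> (LINT y|lborel. f (x + t *\<^sub>R axis i 1 + y) * K y) = 0"
  shows "(LINT y|lborel. f (x + y) * K' y) = 0"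
proof -
  \<comment> \<open>a null sequence of non-zero increments, all less than \<open>e\<close>\<close>
  define \<tau> where "\<tau> m = e / real (Suc (Suc m))" for m
  have \<tau>: "0 < \<tau> m" "\<tau> m < e" for m
  proof -
    show "0 < \<tau> m" using e by (simp add: \<tau>_def)
    have "e * 1 < e * real (Suc (Suc m))" using e by (intro mult_strict_left_mono) auto
    then show "\<tau> m < e" by (simp add: \<tau>_def pos_divide_less_eq del: of_nat_Suc)
  qed
  have \<tau>0: "\<tau> \<longlonglongrightarrow> 0"
    unfolding \<tau>_def by (rule LIMSEQ_Suc[OF LIMSEQ_Suc[OF lim_const_over_n]])
  let ?b = "axis i 1 :: real ^ 'n"
  define Q where "Q m z = (K (z + \<tau> m *\<^sub>R ?b) - K z) / complex_of_real (\<tau> m)" for m z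
  \<comment> \<open>the hypothesis at \<open>x - t e\<^sub>i\<close>, translated\<close>
  have shifted: "(LINT z|lborel. f (x + z) * K (z + t *\<^sub>R ?b)) = 0" if "\<bar>t\<bar> < e" for t
  proof -
    have m: "(\<lambda>z. f (x + z) * K (z + t *\<^sub>R ?b)) \<in> borel_measurable borel"
      by (intro borel_measurable_continuous_onI continuous_intros continuous_on_compose2[OF f(1)] continuous_on_compose2[OF K(1)]) auto
    have "(LINT z|lborel. f (x + z) * K (z + t *\<^sub>R ?b)) =
        (LINT z|distr lborel borel ((+) (- (t *\<^sub>R ?b))). f (x + z) * K (z + t *\<^sub>R ?b))"
      by (simp only: lborel_distr_plus)
    also have "\<dots> = (LINT y|lborel. f (x + (- t) *\<^sub>R ?b + y) * K y)"
      by (subst integral_distr) (use m in \<open>simp_all add: algebra_simps\<close>)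
    also have "\<dots> = 0" using that by (intro zero) simp
    finally show ?thesis .
  qed
  have int: "integrable lborel (\<lambda>z. f (x + z) * K (z + t *\<^sub>R ?b))" for t
    by (intro integrable_rapid_kernel f poly_growth_translate K(2) continuous_on_compose2[OF K(1)] continuous_intros) auto
  have Q0: "(LINT z|lborel. f (x + z) * Q m z) = 0" for m
  proof -
    have "(LINT z|lborel. f (x + z) * Q m z) =
       (LINT z|lborel. (f (x + z) * K (z + \<tau> m *\<^sub>R ?b) - f (x + z) * K (z + 0 *\<^sub>R ?b)) / complex_of_real (\<tau> m))"
      by (simp add: Q_def right_diff_distrib)
    also have "\<dots> = ((LINT z|lborel. f (x + z) * K (z + \<tau> m *\<^sub>R ?b)) - (LINT z|lborel. f (x + z) * K (z + 0 *\<^sub>R ?b))) / complex_of_real (\<tau> m)"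
      by (simp only: integral_divide_zero Bochner_Integration.integral_diff[OF int int])
    also have "\<dots> = 0"
      using \<tau>[of m] e by (simp only: shifted abs_of_pos abs_zero) simp
    finally show ?thesis .
  qed
  obtain D N where D: "D \<ge> 0" "\<And>z. norm (K' z) \<le> D * (1 + norm z) ^ N"
    using K'(2) by (rule poly_growthE) blast
  define M where "M z = D * (1 + e) ^ N * (1 + norm z) ^ N" for z :: "real ^ 'n"
  have Qbound: "norm (Q m z) \<le> M z" for m z
  proof -
    have "norm (K (z + \<tau> m *\<^sub>R ?b) - K z) \<le> \<tau> m * M z"
    proof (rule has_partial_increment_bound[OF partial _ \<tau>(1)])
      fix s assume s: "0 < s" "s < \<tau> m"
      have "norm (z + s *\<^sub>R ?b) \<le> norm z + e"
        using norm_triangle_ineq[of z "s *\<^sub>R ?b"] s \<tau>[of m] by simp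
      moreover have "(1 + e) * (1 + norm z) = 1 + norm z + e + e * norm z" by (simp add: algebra_simps)
      moreover have "e * norm z \<ge> 0" using e by simp
      ultimately have "1 + norm (z + s *\<^sub>R ?b) \<le> (1 + e) * (1 + norm z)" by linarith
      then have "D * (1 + norm (z + s *\<^sub>R ?b)) ^ N \<le> D * ((1 + e) * (1 + norm z)) ^ N"
        by (intro mult_left_mono power_mono D) auto
      with D(2)[of "z + s *\<^sub>R ?b"] show "norm (K' (z + s *\<^sub>R ?b)) \<le> M z"
        by (simp add: M_def power_mult_distrib mult.assoc)
    qed
    then have "norm (K (z + \<tau> m *\<^sub>R ?b) - K z) / \<tau> m \<le> M z"
      using \<tau>(1)[of m] by (simp add: pos_divide_le_eq mult.commute)
    then show ?thesis
      using \<tau>(1)[of m] by (simp add: Q_def norm_divide)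
  qed
  have "(\<lambda>m. LINT z|lborel. f (x + z) * Q m z) \<longlonglongrightarrow> (LINT z|lborel. f (x + z) * K' z)"
  proof (rule integral_dominated_convergence)
    show "(\<lambda>z. f (x + z) * K' z) \<in> borel_measurable lborel"
      using integrable_rapid_kernel[OF f K'] by (rule borel_measurable_integrable)
    show "(\<lambda>z. f (x + z) * Q m z) \<in> borel_measurable lborel" for m
    proof -
      have "integrable lborel (\<lambda>z. (f (x + z) * K (z + \<tau> m *\<^sub>R ?b) - f (x + z) * K (z + 0 *\<^sub>R ?b)) / complex_of_real (\<tau> m))"
        by (intro integrable_divide Bochner_Integration.integrable_diff int)
      then show ?thesis
        by (intro borel_measurable_integrable) (simp add: Q_def right_diff_distrib)
    qed
    have "integrable lborel (\<lambda>z. f (x + z) * complex_of_real (M z))"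
    proof (rule integrable_rapid_kernel[OF f])
      show "continuous_on UNIV (\<lambda>z. complex_of_real (M z))" unfolding M_def by (intro continuous_intros)
      show "poly_growth (\<lambda>z. complex_of_real (M z))"
      proof (rule poly_growthI)
        fix z
        have "0 \<le> M z" unfolding M_def using D(1) e by (intro mult_nonneg_nonneg zero_le_power) auto
        then show "norm (complex_of_real (M z)) \<le> (D * (1 + e) ^ N) * (1 + norm z) ^ N"
          by (simp only: norm_of_real abs_of_nonneg) (simp add: M_def)
      qed
    qed
    then show "integrable lborel (\<lambda>z. norm (f (x + z) * complex_of_real (M z)))" by (rule integrable_norm)
    show "AE z in lborel. norm (f (x + z) * Q m z) \<le> norm (f (x + z) * complex_of_real (M z))" for m
    proof (rule AE_I2)
      fix z
      have "norm (Q m z) \<le> norm (complex_of_real (M z))"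
        using Qbound[of m z] by simp
      then show "norm (f (x + z) * Q m z) \<le> norm (f (x + z) * complex_of_real (M z))"
        unfolding norm_mult by (intro mult_left_mono) auto
    qed
    show "AE z in lborel. (\<lambda>m. f (x + z) * Q m z) \<longlonglongrightarrow> f (x + z) * K' z"
    proof (rule AE_I2)
      fix z
      have "\<tau> m \<noteq> 0" for m using \<tau>(1)[of m] by simp
      then show "(\<lambda>m. f (x + z) * Q m z) \<longlonglongrightarrow> f (x + z) * K' z"
        unfolding Q_def by (intro tendsto_mult tendsto_const has_partial_quotient_tendsto[OF partial \<tau>0])
    qed
  qed
  then have "(\<lambda>m::nat. 0) \<longlonglongrightarrow> (LINT z|lborel. f (x + z) * K' z)" unfolding Q0 .
  then show ?thesis by (simp only: LIMSEQ_const_iff)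
qed

section \<open>Exterior integrals and the descent to degree zero\<close>

text \<open>The strict inequality makes the range of \<open>x\<close> open for given \<open>\<rho>\<close>, so that the identity can be
differentiated in \<open>x\<close>.\<close>

definition exterior_null :: "real \<Rightarrow> (real ^ 'n::finite \<Rightarrow> complex) \<Rightarrow> (real ^ 'n \<Rightarrow> complex) \<Rightarrow> bool" where
  "exterior_null B f S \<longleftrightarrow> (\<forall>x \<rho> u. admissible \<rho> u \<longrightarrow> (norm x + B)\<^sup>2 < \<rho> \<longrightarrow>
     (LINT y|lborel. f (x + y) * (S y * complex_of_real (u (y \<bullet> y)))) = 0)"

lemma integrable_exterior_kernel:
  fixes f S :: "real ^ 'n::finite \<Rightarrow> complex"
  assumes "continuous_on UNIV f" "rapidly_decreasing f" "continuous_on UNIV S" "poly_growth S" "admissible \<rho> u"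
  shows "integrable lborel (\<lambda>y. f (x + y) * (S y * complex_of_real (u (y \<bullet> y))))"
  using assms by (intro integrable_rapid_kernel continuous_on_mult poly_growth_mult continuous_on_radial poly_growth_of_radial)
    (auto simp: admissible_def)

text \<open>On the sphere of radius \<open>r\<close> the weight is the constant \<open>u(r\<^sup>2)\<close>, and this is \<open>0\<close> unless
\<open>r > |x| + B\<close>, when the mean vanishes.\<close>

lemma exterior_null_of_spherical_means:
  fixes f S :: "real ^ 'n::finite \<Rightarrow> complex"
  assumes f: "continuous_on UNIV f" "rapidly_decreasing f" and S: "continuous_on UNIV S" "poly_growth S"
    and B: "B \<ge> 0" and zero: "\<And>x r. r > norm x + B \<Longrightarrow> weighted_spherical_mean f S r x = 0"
  shows "exterior_null B f S"
  unfolding exterior_null_def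
proof (intro allI impI)
  fix x :: "real ^ 'n" and \<rho> u
  assume u: "admissible \<rho> u" and \<rho>: "(norm x + B)\<^sup>2 < \<rho>"
  show "(LINT y|lborel. f (x + y) * (S y * complex_of_real (u (y \<bullet> y)))) = 0"
  proof (rule lborel_integral_eq_0_of_sphere_means[OF integrable_exterior_kernel[OF f S u]])
    fix r :: real assume r: "r > 0"
    have borel: "F \<in> borel_measurable (sphere_measure r)" if "continuous_on UNIV F" for F :: "real ^ 'n \<Rightarrow> complex"
      using borel_measurable_continuous_onI[OF that] unfolding sphere_measure_def by simp
    have "continuous_on UNIV (\<lambda>y. f (x + y))"
      by (intro continuous_on_compose2[OF f(1)] continuous_intros) auto
    moreover have "continuous_on UNIV u" using u by (simp add: admissible_def)
    ultimately have m:
      "(\<lambda>y. f (x + y) * (S y * complex_of_real (u (y \<bullet> y)))) \<in> borel_measurable (sphere_measure r)"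
      "(\<lambda>y. f (x + y) * S y * complex_of_real (u (r\<^sup>2))) \<in> borel_measurable (sphere_measure r)"
      by (auto intro!: borel continuous_on_mult continuous_on_const S continuous_on_radial)
    have on_sphere: "f (x + y) * (S y * complex_of_real (u (y \<bullet> y))) = f (x + y) * S y * complex_of_real (u (r\<^sup>2))"
      if "y \<in> sphere 0 r" for y
      using that by (simp add: power2_norm_eq_inner[symmetric])
    have "(LINT y|sphere_measure r. f (x + y) * (S y * complex_of_real (u (y \<bullet> y)))) =
        (LINT y|sphere_measure r. f (x + y) * S y * complex_of_real (u (r\<^sup>2)))"
      by (rule integral_cong_AE[OF m]) (rule eventually_mono[OF AE_sphere_measure[OF r] on_sphere])
    also have "\<dots> = weighted_spherical_mean f S r x * complex_of_real (u (r\<^sup>2))"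
      by (simp add: weighted_spherical_mean_def)
    also have "\<dots> = 0"
    proof (cases "r\<^sup>2 \<le> \<rho>")
      case True
      then show ?thesis using u by (simp add: admissible_def)
    next
      case False
      then have "(norm x + B)\<^sup>2 < r\<^sup>2" using \<rho> by simp
      then have "norm x + B < r" using r by (intro power2_less_imp_less[of _ r]) auto
      then show ?thesis using zero by simp
    qed
    finally show "(LINT y|sphere_measure r. f (x + y) * (S y * complex_of_real (u (y \<bullet> y)))) = 0" .
  qed
qed

text \<open>The increment of \<open>x\<close> may have any length less than \<open>\<surd>\<rho> - (|x| + B)\<close>. Integrability is part of
the conclusion, for use in sums over \<open>i\<close>.\<close>

lemma exterior_null_partial:
  fixes f Q :: "real ^ 'n::finite \<Rightarrow> complex"
  assumes f: "continuous_on UNIV f" "rapidly_decreasing f" and B: "B \<ge> 0" and Q: "Q \<in> homogeneous_polynomials k"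
    and null: "exterior_null B f Q" and h: "admissible \<rho> h" and h': "admissible \<rho> h'"
    and deriv: "\<And>q. (h has_real_derivative h' q) (at q)" and \<rho>: "(norm x + B)\<^sup>2 < \<rho>"
  shows "has_bochner_integral lborel (\<lambda>y. f (x + y) * (partial_derivative i Q y * complex_of_real (h (y \<bullet> y))
     + Q y * complex_of_real (2 * y $ i * h' (y \<bullet> y)))) 0"
proof -
  note dQ = partial_derivative_homogeneous[OF Q, of i]
  note cont = continuous_on_homogeneous[OF Q] continuous_on_homogeneous[OF dQ]
  note grow = poly_growth_homogeneous[OF Q] poly_growth_homogeneous[OF dQ]
  have ch: "continuous_on UNIV h" "continuous_on UNIV h'" and gh: "poly_growth h" "poly_growth h'"
    using h h' by (auto simp: admissible_def)
  have partial: "has_partial i (\<lambda>y. Q y * complex_of_real (h (y \<bullet> y))) (\<lambda>y. partial_derivative i Q y * complex_of_real (h (y \<bullet> y))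
     + Q y * complex_of_real (2 * y $ i * h' (y \<bullet> y)))"
    by (intro has_partial_mult has_partial_homogeneous[OF Q] has_partial_radial deriv)
  have K: "continuous_on UNIV (\<lambda>y. Q y * complex_of_real (h (y \<bullet> y)))"
    "poly_growth (\<lambda>y. Q y * complex_of_real (h (y \<bullet> y)))"
    by (intro continuous_on_mult cont continuous_on_radial ch, intro poly_growth_mult grow poly_growth_of_radial gh)
  have K'1: "continuous_on UNIV (\<lambda>y. partial_derivative i Q y * complex_of_real (h (y \<bullet> y))
     + Q y * complex_of_real (2 * y $ i * h' (y \<bullet> y)))"
    unfolding of_real_mult
    by (intro continuous_on_add continuous_on_mult cont continuous_on_radial ch continuous_intros)
  have K'2: "poly_growth (\<lambda>y. partial_derivative i Q y * complex_of_real (h (y \<bullet> y))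
     + Q y * complex_of_real (2 * y $ i * h' (y \<bullet> y)))"
    unfolding of_real_mult
    by (intro poly_growth_add poly_growth_mult grow poly_growth_of_radial gh poly_growth_const poly_growth_nth)
  have e: "sqrt \<rho> - (norm x + B) > 0"
    using real_less_rsqrt[OF \<rho>] by simp
  have zero: "(LINT y|lborel. f (x + t *\<^sub>R axis i 1 + y) * (Q y * complex_of_real (h (y \<bullet> y)))) = 0"
    if t: "\<bar>t\<bar> < sqrt \<rho> - (norm x + B)" for t
  proof -
    have "norm (x + t *\<^sub>R axis i 1) \<le> norm x + \<bar>t\<bar>"
      using norm_triangle_ineq[of x "t *\<^sub>R axis i 1"] by simp
    then have "norm (x + t *\<^sub>R axis i 1) + B < sqrt \<rho>" using t by simp
    then have "(norm (x + t *\<^sub>R axis i 1) + B)\<^sup>2 < (sqrt \<rho>)\<^sup>2"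
      using B by (intro power_strict_mono) auto
    also have "(sqrt \<rho>)\<^sup>2 = \<rho>"
      using \<rho> by (intro real_sqrt_pow2) (meson zero_le_power2 less_imp_le order_trans)
    finally show ?thesis
      using null h unfolding exterior_null_def by blast
  qed
  show ?thesis
    unfolding has_bochner_integral_iff
    using integrable_rapid_kernel[OF f K'1 K'2] integral_partial_eq_0[OF f K K'1 K'2 partial e zero] by blast
qed

lemma exterior_null_add:
  fixes f S T :: "real ^ 'n::finite \<Rightarrow> complex"
  assumes f: "continuous_on UNIV f" "rapidly_decreasing f" and S: "continuous_on UNIV S" "poly_growth S"
    and T: "continuous_on UNIV T" "poly_growth T" and null: "exterior_null B f S" "exterior_null B f T"
  shows "exterior_null B f (\<lambda>y. S y + T y)"
  unfolding exterior_null_def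
proof (intro allI impI)
  fix x :: "real ^ 'n" and \<rho> u
  assume u: "admissible \<rho> u" and \<rho>: "(norm x + B)\<^sup>2 < \<rho>"
  have "(LINT y|lborel. f (x + y) * (S y * complex_of_real (u (y \<bullet> y))) + f (x + y) * (T y * complex_of_real (u (y \<bullet> y)))) = 0 + 0"
    using null u \<rho> unfolding exterior_null_def
    by (subst Bochner_Integration.integral_add[OF integrable_exterior_kernel[OF f S u] integrable_exterior_kernel[OF f T u]]) simp
  then show "(LINT y|lborel. f (x + y) * ((S y + T y) * complex_of_real (u (y \<bullet> y)))) = 0"
    by (simp add: distrib_left distrib_right)
qed

lemma exterior_null_cmult:
  fixes f S :: "real ^ 'n::finite \<Rightarrow> complex"
  assumes "exterior_null B f S"
  shows "exterior_null B f (\<lambda>y. c * S y)"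
  unfolding exterior_null_def
proof (intro allI impI)
  fix x :: "real ^ 'n" and \<rho> u
  assume u: "admissible \<rho> u" and \<rho>: "(norm x + B)\<^sup>2 < \<rho>"
  have "(LINT y|lborel. c * (f (x + y) * (S y * complex_of_real (u (y \<bullet> y))))) = 0"
    using assms u \<rho> unfolding exterior_null_def by simp
  then show "(LINT y|lborel. f (x + y) * (c * S y * complex_of_real (u (y \<bullet> y)))) = 0"
    by (simp only: mult.assoc mult.left_commute[of c])
qed

text \<open>The divergence of the field \<open>raised_harmonic l S i\<close> times \<open>h(|y|\<^sup>2)\<close> is, up to a non-zero factor,
\<open>S\<close> times \<open>a h + q h'\<close> with \<open>a = (n + 2l) / 2\<close>, and the Euler equation allows an arbitrary weight
there.\<close>

lemma exterior_null_lower_degree: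
  fixes f S :: "real ^ 'n::finite \<Rightarrow> complex"
  assumes n: "CARD('n) \<ge> 2" and B: "B \<ge> 0" and f: "continuous_on UNIV f" "rapidly_decreasing f"
    and null: "\<And>Q. Q \<in> solid_harmonics (Suc l) \<Longrightarrow> exterior_null B f Q" and S: "S \<in> solid_harmonics l"
  shows "exterior_null B f S"
  unfolding exterior_null_def
proof (intro allI impI)
  fix x :: "real ^ 'n" and \<rho> u
  assume u: "admissible \<rho> u" and \<rho>: "(norm x + B)\<^sup>2 < \<rho>"
  note hS = solid_harmonicsD(1)[OF S]
  \<comment> \<open>the exponent for which the Euler operator is the divergence computed above\<close>
  let ?a = "real (CARD('n) + 2 * l) / 2" and ?c = "2 * raising_constant TYPE('n) l"
  have "\<rho> > 0" using le_less_trans[OF zero_le_power2 \<rho>] .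
  moreover have "?a \<ge> 1" using n by simp
  ultimately obtain h h' where h: "admissible \<rho> h" "admissible \<rho> h'" "\<And>q. (h has_real_derivative h' q) (at q)"
    and ode: "\<And>q. ?a * h q + q * h' q = u q"
    using u by (rule_tac admissible_euler_ode[of \<rho> u ?a]) auto
  let ?F = "\<lambda>i y. f (x + y) * (partial_derivative i (raised_harmonic l S i) y * complex_of_real (h (y \<bullet> y))
     + raised_harmonic l S i y * complex_of_real (2 * y $ i * h' (y \<bullet> y)))"
  have "has_bochner_integral lborel (?F i) 0" for i
    by (rule exterior_null_partial[OF f B raised_harmonic_homogeneous[OF hS] null[OF raised_harmonic_harmonic[OF n S]] h \<rho>])
  then have "has_bochner_integral lborel (\<lambda>y. \<Sum>i\<in>UNIV. ?F i y) (\<Sum>i\<in>(UNIV :: 'n set). 0)"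
    by (rule has_bochner_integral_sum)
  moreover have "(\<Sum>i\<in>UNIV. ?F i y) = ?c * (f (x + y) * (S y * complex_of_real (u (y \<bullet> y))))" for y
  proof -
    have "(\<Sum>i\<in>UNIV. ?F i y) = f (x + y) * ((\<Sum>i\<in>UNIV. partial_derivative i (raised_harmonic l S i) y) * complex_of_real (h (y \<bullet> y))
        + (\<Sum>i\<in>UNIV. complex_of_real (y $ i) * raised_harmonic l S i y) * complex_of_real (2 * h' (y \<bullet> y)))"
      unfolding sum_distrib_left sum_distrib_right sum.distrib[symmetric]
      by (rule sum.cong) (simp_all add: algebra_simps)
    also have "\<dots> = ?c * (f (x + y) * (S y * (of_nat (CARD('n) + 2 * l) / 2 * complex_of_real (h (y \<bullet> y))
        + complex_of_real (y \<bullet> y) * complex_of_real (h' (y \<bullet> y)))))"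
      unfolding divergence_raised_harmonic[OF n S] radial_component_raised_harmonic[OF hS]
      by (simp add: algebra_simps)
    also have "of_nat (CARD('n) + 2 * l) / 2 * complex_of_real (h (y \<bullet> y)) + complex_of_real (y \<bullet> y) * complex_of_real (h' (y \<bullet> y))
        = complex_of_real (u (y \<bullet> y))"
      unfolding ode[symmetric] by simp
    finally show ?thesis .
  qed
  ultimately have "(LINT y|lborel. ?c * (f (x + y) * (S y * complex_of_real (u (y \<bullet> y))))) = 0"
    by (simp add: has_bochner_integral_iff)
  then show "(LINT y|lborel. f (x + y) * (S y * complex_of_real (u (y \<bullet> y)))) = 0"
    using raising_constant_nonzero[OF n, of l] by (simp only: integral_mult_right_zero mult_eq_0_iff) simp
qed

lemma constant_harmonic: "(\<lambda>_. 1) \<in> solid_harmonics 0"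
proof -
  have "monomial (\<lambda>_. 0) = (\<lambda>x :: real ^ 'a. 1)" by (simp add: monomial_def fun_eq_iff)
  then have "(\<lambda>x :: real ^ 'a. 1) \<in> homogeneous_polynomials 0"
    using homogeneous_monomial[of "\<lambda>_ :: 'a. 0" 0] by simp
  then show ?thesis
    by (simp add: solid_harmonics_def laplacian_def partial_derivative_eq[OF has_partial_const])
qed

lemma exterior_null_degree_0:
  fixes f :: "real ^ 'n::finite \<Rightarrow> complex"
  assumes n: "CARD('n) \<ge> 2" and B: "B \<ge> 0" and f: "continuous_on UNIV f" "rapidly_decreasing f"
    and null: "\<And>Q. Q \<in> solid_harmonics k \<Longrightarrow> exterior_null B f Q"
  shows "exterior_null B f (\<lambda>_. 1)"
  using null
proof (induction k)
  case 0
  then show ?case using constant_harmonic by blast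
next
  case (Suc l)
  show ?case
    by (rule Suc.IH) (rule exterior_null_lower_degree[OF n B f Suc.prems])
qed

section \<open>Products with polynomials\<close>

text \<open>The derivative of \<open>h(|y|\<^sup>2)\<close> in direction \<open>i\<close> is \<open>2 y\<^sub>i h'(|y|\<^sup>2)\<close>, so the weight \<open>h' = u / 2\<close> shows
that the integral of \<open>f (x + y) y\<^sub>i u(|y|\<^sup>2)\<close> is \<open>0\<close>. Adding \<open>x\<^sub>i\<close> times the integral of
\<open>f (x + y) u(|y|\<^sup>2)\<close> replaces \<open>y\<^sub>i\<close> by \<open>(x + y)\<^sub>i\<close>.\<close>

lemma exterior_null_coord_mult:
  fixes f :: "real ^ 'n::finite \<Rightarrow> complex"
  assumes B: "B \<ge> 0" and f: "continuous_on UNIV f" "rapidly_decreasing f" and null: "exterior_null B f (\<lambda>_. 1)"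
  shows "exterior_null B (\<lambda>z. f z * complex_of_real (z $ i)) (\<lambda>_. 1)"
  unfolding exterior_null_def
proof (intro allI impI)
  fix x :: "real ^ 'n" and \<rho> u
  assume u: "admissible \<rho> u" and \<rho>: "(norm x + B)\<^sup>2 < \<rho>"
  have \<rho>0: "\<rho> > 0" using le_less_trans[OF zero_le_power2 \<rho>] .
  have u2: "admissible \<rho> (\<lambda>q. u q * (1 / 2))"
    using u unfolding admissible_def
    by (intro conjI continuous_on_mult poly_growth_mult poly_growth_const continuous_on_const) simp_all
  obtain W where W: "admissible \<rho> W" "\<And>q. (W has_real_derivative u q * (1 / 2)) (at q)"
    using admissible_primitive[OF u2 \<rho>0] by blast
  have one: "(\<lambda>_ :: real ^ 'n. 1 :: complex) \<in> homogeneous_polynomials 0"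
    using solid_harmonicsD(1)[OF constant_harmonic] .
  have "partial_derivative i (\<lambda>_ :: real ^ 'n. 1 :: complex) = (\<lambda>_. 0)"
    by (rule partial_derivative_eq[OF has_partial_const])
  then have rel: "has_bochner_integral lborel (\<lambda>y. f (x + y) * complex_of_real (y $ i * u (y \<bullet> y))) 0"
    using exterior_null_partial[OF f B one null W(1) u2 W(2) \<rho>, of i] by simp
  have "integrable lborel (\<lambda>y. f (x + y) * (1 * complex_of_real (u (y \<bullet> y))))"
    by (rule integrable_exterior_kernel[OF f continuous_on_const poly_growth_const u])
  moreover have "(LINT y|lborel. f (x + y) * (1 * complex_of_real (u (y \<bullet> y)))) = 0"
    using null u \<rho> unfolding exterior_null_def by blast
  ultimately have "has_bochner_integral lborel (\<lambda>y. complex_of_real (x $ i) * (f (x + y) * (1 * complex_of_real (u (y \<bullet> y))))) (complex_of_real (x $ i) * 0)"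
    by (intro has_bochner_integral_mult_right) (simp add: has_bochner_integral_iff)
  from has_bochner_integral_add[OF this rel]
  have "has_bochner_integral lborel (\<lambda>y. f (x + y) * complex_of_real ((x + y) $ i) * (1 * complex_of_real (u (y \<bullet> y)))) 0"
    by (simp add: algebra_simps)
  then show "(LINT y|lborel. f (x + y) * complex_of_real ((x + y) $ i) * (1 * complex_of_real (u (y \<bullet> y)))) = 0"
    by (simp only: has_bochner_integral_iff)
qed

text \<open>The three properties are bundled because together they pass from \<open>f\<close> to its products with
polynomials.\<close>

definition exterior_null_function :: "real \<Rightarrow> (real ^ 'n::finite \<Rightarrow> complex) \<Rightarrow> bool" where
  "exterior_null_function B f \<longleftrightarrow> continuous_on UNIV f \<and> rapidly_decreasing f \<and> exterior_null B f (\<lambda>_. 1)"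

lemma exterior_null_function_add:
  assumes "exterior_null_function B f" "exterior_null_function B g"
  shows "exterior_null_function B (\<lambda>z. f z + g z)"
proof -
  have f: "continuous_on UNIV f" "rapidly_decreasing f" "exterior_null B f (\<lambda>_. 1)"
    and g: "continuous_on UNIV g" "rapidly_decreasing g" "exterior_null B g (\<lambda>_. 1)"
    using assms by (auto simp: exterior_null_function_def)
  have "exterior_null B (\<lambda>z. f z + g z) (\<lambda>_. 1)"
    unfolding exterior_null_def
  proof (intro allI impI)
    fix x :: "real ^ 'a" and \<rho> u
    assume u: "admissible \<rho> u" and \<rho>: "(norm x + B)\<^sup>2 < \<rho>"
    have "(LINT y|lborel. f (x + y) * (1 * complex_of_real (u (y \<bullet> y))) + g (x + y) * (1 * complex_of_real (u (y \<bullet> y)))) = 0 + 0"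
      using f(3) g(3) u \<rho> unfolding exterior_null_def
      by (subst Bochner_Integration.integral_add[OF integrable_exterior_kernel[OF f(1,2) continuous_on_const poly_growth_const u]
            integrable_exterior_kernel[OF g(1,2) continuous_on_const poly_growth_const u]]) simp
    then show "(LINT y|lborel. (f (x + y) + g (x + y)) * (1 * complex_of_real (u (y \<bullet> y)))) = 0"
      by (simp add: distrib_right)
  qed
  then show ?thesis
    using f g by (simp add: exterior_null_function_def continuous_on_add rapidly_decreasing_add)
qed

lemma exterior_null_function_mult_const:
  assumes "exterior_null_function B f"
  shows "exterior_null_function B (\<lambda>z. f z * c)"
proof -
  have f: "continuous_on UNIV f" "rapidly_decreasing f" "exterior_null B f (\<lambda>_. 1)"
    using assms by (auto simp: exterior_null_function_def)
  have "exterior_null B (\<lambda>z. f z * c) (\<lambda>_. 1)"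
    using exterior_null_cmult[OF f(3), of c] by (simp add: exterior_null_def mult.assoc)
  then show ?thesis
    using f by (simp add: exterior_null_function_def continuous_on_mult rapidly_decreasing_mult poly_growth_const)
qed

lemma exterior_null_function_coord_mult:
  assumes "B \<ge> 0" "exterior_null_function B f"
  shows "exterior_null_function B (\<lambda>z. f z * complex_of_real (z $ i))"
proof -
  have "continuous_on UNIV (\<lambda>z::real ^ 'a. complex_of_real (z $ i))" by (intro continuous_intros)
  then show ?thesis
    using assms by (simp add: exterior_null_function_def exterior_null_coord_mult continuous_on_mult rapidly_decreasing_mult poly_growth_nth)
qed

lemma exterior_null_function_polynomial_mult:
  fixes f :: "real ^ 'n::finite \<Rightarrow> complex"
  assumes B: "B \<ge> 0" and f: "exterior_null_function B f" and p: "real_polynomial_function p"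
  shows "exterior_null_function B (\<lambda>z. f z * complex_of_real (p z))"
  using p f
proof (induction p arbitrary: f rule: real_polynomial_function.induct)
  case (linear p)
  have sum: "exterior_null_function B (\<lambda>z. \<Sum>i\<in>I. F i z)" if "\<And>i. exterior_null_function B (F i)" "finite I" "I \<noteq> {}"
    for F :: "'n \<Rightarrow> real ^ 'n \<Rightarrow> complex" and I
    using that(2,3) by (induction I rule: finite_ne_induct) (auto intro: that(1) exterior_null_function_add)
  have expand: "p z = (\<Sum>i\<in>UNIV. z $ i * p (axis i 1))" for z
  proof -
    have "(\<Sum>i\<in>UNIV. z $ i *\<^sub>R axis i 1) = z"
      using basis_expansion[of z] by (simp only: scalar_mult_eq_scaleR)
    then have "p z = p (\<Sum>i\<in>UNIV. z $ i *\<^sub>R axis i 1)" by simp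
    also have "\<dots> = (\<Sum>i\<in>UNIV. z $ i * p (axis i 1))"
      using bounded_linear.linear[OF linear(1)] by (simp only: linear_sum linear_cmul real_scaleR_def)
    finally show ?thesis .
  qed
  have "f z * complex_of_real (p z) = (\<Sum>i\<in>UNIV. f z * complex_of_real (z $ i) * complex_of_real (p (axis i 1)))" for z
    unfolding expand[of z] by (simp only: of_real_sum of_real_mult sum_distrib_left mult.assoc)
  then show ?case
    using sum[of "\<lambda>i z. f z * complex_of_real (z $ i) * complex_of_real (p (axis i 1))" UNIV]
    by (simp add: exterior_null_function_mult_const exterior_null_function_coord_mult[OF B linear(2)])
next
  case (const c)
  then show ?case by (rule exterior_null_function_mult_const)
next
  case (add p q)
  have "exterior_null_function B (\<lambda>z. f z * complex_of_real (p z) + f z * complex_of_real (q z))"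
    by (intro exterior_null_function_add add)
  then show ?case by (simp add: distrib_left)
next
  case (mult p q)
  have "exterior_null_function B (\<lambda>z. f z * complex_of_real (p z) * complex_of_real (q z))"
    by (intro mult)
  then show ?case by (simp add: mult.assoc)
qed

section \<open>Orthogonality to all polynomials\<close>

lemma integrable_continuous_compact_support:
  fixes F :: "'a::euclidean_space \<Rightarrow> real"
  assumes "continuous_on UNIV F" "\<And>y. y \<notin> cball 0 R \<Longrightarrow> F y = 0"
  shows "integrable lborel F"
proof -
  have "bounded (F ` cball 0 R)"
    by (intro compact_imp_bounded compact_continuous_image continuous_on_subset[OF assms(1)]) auto
  then obtain C where "\<And>y. y \<in> cball 0 R \<Longrightarrow> norm (F y) \<le> C" unfolding bounded_iff by blast
  then show ?thesis
    using assms(2) borel_measurable_continuous_onI[OF assms(1)] emeasure_lborel_cball_finite[of "0::'a" R]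
    by (intro integrableI_bounded_set[where A="cball 0 R" and B=C]) auto
qed

lemma continuous_nonneg_integral_0_imp_0:
  fixes F :: "'a::euclidean_space \<Rightarrow> real"
  assumes F: "continuous_on UNIV F" "integrable lborel F" "\<And>y. F y \<ge> 0" "(LINT y|lborel. F y) = 0"
  shows "F y = 0"
proof (rule ccontr)
  assume "F y \<noteq> 0"
  have op: "open {y. F y \<noteq> 0}"
    by (rule open_Collect_neq[OF F(1) continuous_on_const])
  have "AE y in lborel. F y = 0"
    using integral_nonneg_eq_0_iff_AE[OF F(2)] F(3,4) by simp
  moreover have "{y. F y \<noteq> 0} \<in> sets lborel" using op by simp
  ultimately have "{y. F y \<noteq> 0} \<in> null_sets lborel"
    by (subst (asm) AE_iff_null) (auto simp: borel_measurable_continuous_onI[OF F(1)])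
  then have "negligible {y. F y \<noteq> 0}"
    unfolding negligible_iff_null_sets by (rule null_sets_completionI)
  then show False using open_not_negligible[OF op] \<open>F y \<noteq> 0\<close> by blast
qed

text \<open>Approximating \<open>g\<close> by polynomials on the support of \<open>w\<close> shows that the integral of \<open>g\<^sup>2 w\<close> is at
most \<open>e\<close> times that of \<open>|g| w\<close>, for every \<open>e > 0\<close>.\<close>

lemma orthogonal_to_polynomials_imp_0:
  fixes g w :: "'a::euclidean_space \<Rightarrow> real"
  assumes g: "continuous_on UNIV g" and w: "continuous_on UNIV w" "\<And>y. w y \<ge> 0" "\<And>y. y \<notin> cball 0 R \<Longrightarrow> w y = 0"
    and orth: "\<And>p. real_polynomial_function p \<Longrightarrow> (LINT y|lborel. g y * p y * w y) = 0"
  shows "g y * w y = 0"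
proof -
  define A where "A = (LINT y|lborel. \<bar>g y\<bar> * w y)"
  have intA: "integrable lborel (\<lambda>y. \<bar>g y\<bar> * w y)"
    by (intro integrable_continuous_compact_support[where R=R] continuous_on_mult continuous_on_rabs g w) (simp add: w)
  have intF: "integrable lborel (\<lambda>y. g y * g y * w y)"
    by (intro integrable_continuous_compact_support[where R=R] continuous_on_mult g w) (simp add: w)
  have A: "A \<ge> 0" unfolding A_def by (intro integral_nonneg_AE) (simp add: w)
  have bound: "(LINT y|lborel. g y * g y * w y) \<le> e * A" if e: "e > 0" for e
  proof -
    obtain p where p: "real_polynomial_function p" "\<And>y. y \<in> cball 0 R \<Longrightarrow> \<bar>g y - p y\<bar> < e"
      using Stone_Weierstrass_real_polynomial_function[OF compact_cball continuous_on_subset[OF g] e, of "0::'a" R] by auto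
    have cp: "continuous_on UNIV p"
      using p(1) by (intro continuous_at_imp_continuous_on ballI continuous_real_polymonial_function)
    have intp: "integrable lborel (\<lambda>y. g y * p y * w y)"
      by (intro integrable_continuous_compact_support[where R=R] continuous_on_mult g w cp) (simp add: w)
    have "(LINT y|lborel. g y * g y * w y) = (LINT y|lborel. g y * g y * w y - g y * p y * w y)"
      using Bochner_Integration.integral_diff[OF intF intp] orth[OF p(1)] by simp
    also have "\<dots> \<le> (LINT y|lborel. e * (\<bar>g y\<bar> * w y))"
    proof (intro integral_mono)
      fix y
      show "g y * g y * w y - g y * p y * w y \<le> e * (\<bar>g y\<bar> * w y)"
      proof (cases "y \<in> cball 0 R")
        case True
        have "g y * (g y - p y) \<le> \<bar>g y\<bar> * \<bar>g y - p y\<bar>"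
          unfolding abs_mult[symmetric] by (rule abs_ge_self)
        also have "\<dots> \<le> \<bar>g y\<bar> * e" using p(2)[OF True] by (intro mult_left_mono) auto
        finally have "g y * (g y - p y) * w y \<le> \<bar>g y\<bar> * e * w y" by (intro mult_right_mono w)
        then show ?thesis by (simp add: algebra_simps)
      qed (simp add: w)
    qed (intro Bochner_Integration.integrable_diff intF intp integrable_mult_right intA)+
    also have "\<dots> = e * A" by (simp add: A_def)
    finally show ?thesis .
  qed
  have "(LINT y|lborel. g y * g y * w y) \<le> 0"
  proof (rule field_le_epsilon)
    fix e :: real assume "e > 0"
    then have "(LINT y|lborel. g y * g y * w y) \<le> e / (A + 1) * A" using A by (intro bound) auto
    also have "\<dots> \<le> e" using A \<open>e > 0\<close> by (simp add: field_simps)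
    finally show "(LINT y|lborel. g y * g y * w y) \<le> 0 + e" by simp
  qed
  moreover have "(LINT y|lborel. g y * g y * w y) \<ge> 0"
    by (intro integral_nonneg_AE) (simp add: w)
  ultimately have "(LINT y|lborel. g y * g y * w y) = 0" by simp
  then have "g y * g y * w y = 0"
    by (intro continuous_nonneg_integral_0_imp_0[OF _ intF]) (auto intro!: continuous_on_mult g w mult_nonneg_nonneg[OF zero_le_square])
  then show ?thesis by auto
qed

section \<open>Vanishing outside the ball\<close>

text \<open>The bump is supported in \<open>|q - |z|\<^sup>2| \<le> \<delta>\<close>, where \<open>\<delta>\<close> is half the distance of \<open>|z|\<^sup>2\<close> from \<open>B\<^sup>2\<close>, so
that it is admissible at the centre \<open>x = 0\<close> and positive at \<open>z\<close>.\<close>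

lemma exterior_null_function_imp_0:
  fixes f :: "real ^ 'n::finite \<Rightarrow> complex"
  assumes B: "B \<ge> 0" and f: "exterior_null_function B f" and z: "norm z > B"
  shows "f z = 0"
proof -
  define \<delta> where "\<delta> = ((norm z)\<^sup>2 - B\<^sup>2) / 2"
  have "B\<^sup>2 < (norm z)\<^sup>2" using z B by (intro power_strict_mono) auto
  then have \<delta>: "\<delta> > 0" "B\<^sup>2 < (norm z)\<^sup>2 - \<delta>" by (auto simp: \<delta>_def field_simps)
  define u where "u q = max 0 (\<delta> - \<bar>q - (norm z)\<^sup>2\<bar>)" for q
  have cu: "continuous_on UNIV u" unfolding u_def[abs_def] by (intro continuous_intros)
  have "admissible ((norm z)\<^sup>2 - \<delta>) u"
    unfolding admissible_def
  proof (intro conjI)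
    show "poly_growth u"
      using \<delta>(1) by (intro poly_growth_bounded[where C=\<delta>]) (simp add: u_def)
  qed (use cu in \<open>auto simp: u_def\<close>)
  then have null: "(LINT y|lborel. f y * complex_of_real (p y) * complex_of_real (u (y \<bullet> y))) = 0"
    if "real_polynomial_function p" for p
    using exterior_null_function_polynomial_mult[OF B f that] \<delta>(2)
    unfolding exterior_null_function_def exterior_null_def by (auto dest!: spec[of _ "0::real ^ 'n"])
  have cf: "continuous_on UNIV f" and rf: "rapidly_decreasing f"
    using f by (auto simp: exterior_null_function_def)
  define w where "w y = u (y \<bullet> y)" for y :: "real ^ 'n"
  define R where "R = norm z + \<delta> + 1"
  have w: "continuous_on UNIV w" "\<And>y. w y \<ge> 0"
    unfolding w_def[abs_def] by (intro continuous_on_compose2[OF cu] continuous_intros) (auto simp: u_def)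
  have w0: "w y = 0" if "y \<notin> cball 0 R" for y
  proof -
    have "norm y > R" using that by simp
    then have "R\<^sup>2 < (norm y)\<^sup>2" using \<delta>(1) by (intro power_strict_mono) (auto simp: R_def)
    moreover have "(norm z)\<^sup>2 + \<delta> \<le> R\<^sup>2"
    proof -
      have "R\<^sup>2 = (norm z)\<^sup>2 + \<delta> + (\<delta>\<^sup>2 + 1 + \<delta> + 2 * norm z * \<delta> + 2 * norm z)"
        by (simp add: R_def power2_eq_square algebra_simps)
      moreover have "\<delta>\<^sup>2 + 1 + \<delta> + 2 * norm z * \<delta> + 2 * norm z \<ge> 0" using \<delta>(1) by simp
      ultimately show ?thesis by linarith
    qed
    ultimately show ?thesis by (simp add: w_def u_def power2_norm_eq_inner)
  qed
  have int: "integrable lborel (\<lambda>y. f y * complex_of_real (p y) * complex_of_real (w y))" if "real_polynomial_function p" for p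
  proof -
    have "integrable lborel (\<lambda>y. f (0 + y) * complex_of_real (p (0 + y)) * (1 * complex_of_real (u (y \<bullet> y))))"
      using exterior_null_function_polynomial_mult[OF B f that] \<open>admissible _ u\<close>
      unfolding exterior_null_function_def
      by (intro integrable_exterior_kernel[where f="\<lambda>z. f z * complex_of_real (p z)"]) (auto intro: poly_growth_const)
    then show ?thesis by (simp add: w_def)
  qed
  have re: "(LINT y|lborel. Re (f y) * p y * w y) = 0" and im: "(LINT y|lborel. Im (f y) * p y * w y) = 0"
    if "real_polynomial_function p" for p
    using integral_Re[OF int[OF that]] integral_Im[OF int[OF that]] null[OF that] by (simp_all add: w_def)
  have "Re (f z) * w z = 0"
    by (rule orthogonal_to_polynomials_imp_0[OF continuous_on_Re[OF cf] w w0 re])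
  moreover have "Im (f z) * w z = 0"
    by (rule orthogonal_to_polynomials_imp_0[OF continuous_on_Im[OF cf] w w0 im])
  moreover have "w z = \<delta>" using \<delta>(1) by (simp add: w_def u_def power2_norm_eq_inner)
  ultimately show ?thesis using \<delta>(1) by (simp add: complex_eq_iff)
qed

theorem theorem1p5:
  fixes f :: "real ^ 'n::finite \<Rightarrow> complex"
    and P :: "nat \<Rightarrow> real ^ 'n \<Rightarrow> complex"
    and k :: nat and B :: real
  assumes "CARD('n) \<ge> 2" and "B \<ge> 0"
    and "orthonormal_harmonic_basis k P"
    and "smooth f"
    and "\<And>m::nat. bounded (range (\<lambda>x. norm x ^ m *\<^sub>R f x))"
    and "\<And>x r j. r > norm x + B \<Longrightarrow> j \<in> {1..harmonic_dim TYPE('n) k} \<Longrightarrow>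
           weighted_spherical_mean f (P j) r x = 0"
  shows "\<forall>x. norm x > B \<longrightarrow> f x = 0"
proof -
  have "C_class 0 f" using assms(4) unfolding smooth_def by blast
  then have f: "continuous_on UNIV f" "rapidly_decreasing f"
    using rapidly_decreasing_of_moments[OF assms(5)] by auto
  \<comment> \<open>the property is linear in the polynomial, so it passes from the basis to its span\<close>
  let ?T = "{S. continuous_on UNIV S \<and> poly_growth S \<and> exterior_null B f S}"
  have span: "cfun.span (P ` {1..harmonic_dim TYPE('n) k}) = solid_harmonics k"
    and PH: "\<And>j. j \<in> {1..harmonic_dim TYPE('n) k} \<Longrightarrow> P j \<in> homogeneous_polynomials k"
    using assms(3) by (auto simp: orthonormal_harmonic_basis_def solid_harmonics_def)
  have "P j \<in> ?T" if j: "j \<in> {1..harmonic_dim TYPE('n) k}" for j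
  proof -
    note S = continuous_on_homogeneous[OF PH[OF j]] poly_growth_homogeneous[OF PH[OF j]]
    from exterior_null_of_spherical_means[OF f S assms(2) assms(6)[OF _ j]] S show ?thesis by blast
  qed
  then have "P ` {1..harmonic_dim TYPE('n) k} \<subseteq> ?T" by blast
  moreover have "cfun.subspace ?T"
    unfolding cfun.subspace_def cfun_scale_def zero_fun_def plus_fun_def mem_Collect_eq
  proof (intro conjI ballI allI)
    show "exterior_null B f (\<lambda>x. 0)" by (simp add: exterior_null_def)
  qed (auto intro!: poly_growth_const poly_growth_add poly_growth_mult continuous_on_const continuous_on_add continuous_on_mult
      exterior_null_add[OF f] exterior_null_cmult)
  ultimately have "cfun.span (P ` {1..harmonic_dim TYPE('n) k}) \<subseteq> ?T"
    by (rule cfun.span_minimal)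
  then have "exterior_null B f Q" if "Q \<in> solid_harmonics k" for Q
    using that unfolding span by blast
  then have "exterior_null_function B f"
    unfolding exterior_null_function_def using f exterior_null_degree_0[OF assms(1,2) f] by blast
  then show ?thesis
    using exterior_null_function_imp_0[OF assms(2)] by blast
qed

end
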